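(* Let $r\ge1$ be an integer and let $u_r(n)$ be the number of unitary factors of abelian groups of order $n$ whose conjugates have rank at most $r$. Then the associated zeta function $\mathcal U_r(s)=\sum_{n=1}^\infty u_r(n)n^{-s}$ can be written, for $\Re(s)>1$, as $$\mathcal U_r(s)=\frac{\zeta^2(s)\zeta^2(2s)\zeta^2(3s)\cdots\zeta^2(rs)}{\zeta(2s)\zeta(4s)\zeta(6s)\cdots\zeta(2rs)}.$$
   Context: $\zeta$ is the Riemann zeta function. Groups are considered up to isomorphism. A finite abelian group $G$ has unitary factors $H$ and $K$ if $G\cong H\oplus K$ and $H$ and $K$ have no common non-trivial direct factor (up to isomorphism). The number of unitary factors of $G$ is the number of isomorphism classes of groups $H$ for which such a $K$ exists. $u_r(n)$ is the sum, over isomorphism classes of abelian groups $G$ of order $n$ whose conjugate $G'$ has rank at most $r$, of the number of unitary factors of $G$; the paper gives it explicitly as $$u_r(n)=\sum_{n=n_1^r n_2^{r-1}\cdots n_r}2^{\omega(n_1)+\omega(n_2)+\cdots+\omega(n_r)},$$ the sum being over $r$-tuples of positive integers $(n_1,\dots,n_r)$ and $\omega(n)$ denoting the number of distinct prime factors of $n$. The rank of a finite abelian group is its minimal number of generators. Conjugate group: for a prime $p$ and a finite abelian $p$-group $G\cong \mathbb Z/p^{a_1}\mathbb Z\oplus\cdots\oplus\mathbb Z/p^{a_r}\mathbb Z$ with $0\le a_1\le\cdots\le a_r$, the type of $G$ is the partition $\lambda=(a_1,\dots,a_r)$, and the conjugate $G'$ is the finite abelian $p$-group whose type is the conjugate (transposed)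 partition $\lambda'$. For a general finite abelian group, $G'$ is the direct sum of the conjugates of its $p$-primary components. *)

theory Defs
  imports "HOL-Analysis.Analysis" "HOL-Computational_Algebra.Primes" "HOL-Algebra.Product_Groups"
begin

definition fin_ab_group :: "('a, 'b) monoid_scheme \<Rightarrow> bool" where
  "fin_ab_group G \<longleftrightarrow> comm_group G \<and> finite (carrier G)"

text \<open>
  Every finite group is isomorphic to one whose carrier consists of natural numbers, so the
  isomorphism classes of finite abelian groups are the equivalence classes of the following relation
  on \<^typ>\<open>nat monoid\<close>.
\<close>
definition ab_iso :: "(nat monoid \<times> nat monoid) set" where
  "ab_iso = {(G, H). fin_ab_group G \<and> fin_ab_group H \<and> G \<cong> H}"


text \<open>The rank is the minimal number of generators.\<close>

definition group_rank :: "('a, 'b) monoid_scheme \<Rightarrow> nat" where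
  "group_rank G =
     (LEAST k. \<exists>S. S \<subseteq> carrier G \<and> finite S \<and> card S = k \<and> generate G S = carrier G)"


text \<open>
  Partitions are lists of parts in ascending order. For $j = 1, 2, \dots$ up to the largest part of
  \<open>l\<close>, the conjugate partition has a part counting the parts of \<open>l\<close> that are at least $j$.
\<close>
definition conj_partition :: "nat list \<Rightarrow> nat list" where
  "conj_partition l =
     rev (map (\<lambda>j. length (filter (\<lambda>a. j \<le> a) l)) [1..<Suc (Max (insert 0 (set l)))])"

definition group_of_type :: "nat \<Rightarrow> nat list \<Rightarrow> (nat \<Rightarrow> int) monoid" where
  "group_of_type p l = product_group {..<length l} (\<lambda>i. integer_mod_group (p ^ (l ! i)))"

text \<open>
  The type of a finite abelian \<open>p\<close>-group. Zero parts contribute only trivial summands; they are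
  excluded to make the type unique.
\<close>
definition type_of_pgroup :: "nat \<Rightarrow> ('a, 'b) monoid_scheme \<Rightarrow> nat list" where
  "type_of_pgroup p G = (THE l. sorted l \<and> 0 \<notin> set l \<and> G \<cong> group_of_type p l)"

definition primary_component :: "nat \<Rightarrow> ('a, 'b) monoid_scheme \<Rightarrow> ('a, 'b) monoid_scheme" where
  "primary_component p G =
     G\<lparr>carrier := {x \<in> carrier G. \<exists>k::nat. x [^]\<^bsub>G\<^esub> (p ^ k) = \<one>\<^bsub>G\<^esub>}\<rparr>"

definition conjugate_pgroup :: "nat \<Rightarrow> ('a, 'b) monoid_scheme \<Rightarrow> (nat \<Rightarrow> int) monoid" where
  "conjugate_pgroup p G = group_of_type p (conj_partition (type_of_pgroup p G))"

definition conjugate_group :: "('a, 'b) monoid_scheme \<Rightarrow> (nat \<Rightarrow> nat \<Rightarrow> int) monoid" where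
  "conjugate_group G =
     product_group {p. prime p \<and> p dvd order G}
       (\<lambda>p. conjugate_pgroup p (primary_component p G))"


definition direct_factor :: "nat monoid \<Rightarrow> nat monoid \<Rightarrow> bool" where
  "direct_factor D G \<longleftrightarrow>
     fin_ab_group D \<and> (\<exists>A :: nat monoid. fin_ab_group A \<and> G \<cong> D \<times>\<times> A)"

definition unitary_factors :: "nat monoid \<Rightarrow> nat monoid \<Rightarrow> nat monoid \<Rightarrow> bool" where
  "unitary_factors G H K \<longleftrightarrow>
     fin_ab_group H \<and> fin_ab_group K \<and> G \<cong> H \<times>\<times> K \<and>
     \<not> (\<exists>D. direct_factor D H \<and> direct_factor D K \<and> order D \<noteq> 1)"

definition num_unitary_factors :: "nat monoid \<Rightarrow> nat" where
  "num_unitary_factors G = card ({H. \<exists>K. unitary_factors G H K} // ab_iso)"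

text \<open>
  The summand depends only on the isomorphism class \<open>C\<close>, so any representative may be used.
  Only finitely many classes occur.
\<close>
definition unitary_count :: "nat \<Rightarrow> nat \<Rightarrow> nat" where
  "unitary_count r n =
     (\<Sum>C \<in> {G. fin_ab_group G \<and> order G = n \<and> group_rank (conjugate_group G) \<le> r} // ab_iso.
        num_unitary_factors (SOME G. G \<in> C))"


text \<open>
  The Dirichlet series defining the Riemann zeta function; it represents the function only for
  \<open>Re s > 1\<close>, which is the only range in which it is used here.
\<close>
definition riemann_zeta :: "complex \<Rightarrow> complex" where
  "riemann_zeta s = (\<Sum>n. of_nat (Suc n) powr (- s))"

end

theory Submission
  imports Defs "HOL-Number_Theory.Prime_Powers" "HOL-Number_Theory.Cong" "HOL-Algebra.Multiplicative_Group"
begin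

text \<open>
  An isomorphism class of finite abelian groups is a finite multiset of prime powers greater than
  one. The order of the group is the product of the multiset, direct products become sums of
  multisets, and unitary factors \<open>H\<close>, \<open>K\<close> become multisets with disjoint supports. As conjugation
  exchanges the largest part and the number of parts of a partition, the conjugate group has rank at
  most \<open>r\<close> iff all prime powers have exponent at most \<open>r\<close>. So \<open>u\<^sub>r(n)\<close> counts the pairs of disjoint
  multisets \<open>A\<close>, \<open>B\<close> of such prime powers with total product \<open>n\<close>.

  Summing \<open>(\<Prod>M)\<^sup>-\<^sup>s\<close> over all multisets \<open>M\<close> of prime powers of exponent at most \<open>r\<close> gives
  \<open>Z(s) = \<zeta>(s) \<zeta>(2s) \<dots> \<zeta>(rs)\<close>. Any pair of multisets is uniquely \<open>(C + A, C + B)\<close> with \<open>A\<close>, \<open>B\<close>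
  disjoint, hence \<open>Z(s)\<^sup>2 = Z(2s) U\<^sub>r(s)\<close>.
\<close>

subsection \<open>Products of cyclic groups\<close>

text \<open>The passage from classes to multisets needs both halves of the structure theorem. For
  existence, a cyclic subgroup of maximal order is split off a \<open>p\<close>-group. For
  uniqueness, the number of elements killed by \<open>d\<close> is an isomorphism invariant equal to
  the product of \<open>gcd d q\<close> over the type, and these products for prime powers
  \<open>d\<close> determine the multiset.

  No Euler product enters. Sort a multiset by exponent: its \<open>j\<close>-th powers of primes
  form the prime factorisation of one integer \<open>m\<close> with every prime raised to the power
  \<open>j\<close>, and they contribute \<open>m\<close> to the power \<open>-j s\<close>. So each
  exponent \<open>j\<close> yields one factor \<zeta>(js).

  Solving the quadratic identity for the series requires its factor at \<open>2 s\<close> to be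
  nonzero. The zeta values in it have arguments of real part above 2, where the leading term 1
  outweighs the rest of the series.

  The rank condition splits over primes: by the Chinese remainder theorem the rank of a product of
  \<open>p\<close>-groups for different \<open>p\<close> is the maximum of their ranks, not the
  sum.\<close>

definition cyclic_product :: "nat list \<Rightarrow> (nat \<Rightarrow> int) monoid" where
  "cyclic_product l = product_group {..<length l} (\<lambda>i. integer_mod_group (l ! i))"

lemma comm_group_product_group:
  assumes "\<And>i. i \<in> I \<Longrightarrow> comm_group (G i)"
  shows "comm_group (product_group I G)"
proof -
  have gr: "group (product_group I G)"
    using assms by (simp add: comm_group_def)
  show ?thesis
  proof (rule group.group_comm_groupI[OF gr])
    fix x y assume "x \<in> carrier (product_group I G)" "y \<in> carrier (product_group I G)"
    then show "x \<otimes>\<^bsub>product_group I G\<^esub> y = y \<otimes>\<^bsub>product_group I G\<^esub> x"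
      by (auto simp: PiE_iff intro!: restrict_ext comm_monoid.m_comm comm_group.axioms(1) assms)
  qed
qed

lemma comm_group_cyclic_product [simp]: "comm_group (cyclic_product l)"
  by (simp add: cyclic_product_def comm_group_product_group)

lemma group_cyclic_product [simp]: "group (cyclic_product l)"
  using comm_group_cyclic_product comm_group.axioms(2) by blast

lemma comm_group_iso:
  assumes "comm_group G" "group H" "G \<cong> H"
  shows "comm_group H"
proof -
  interpret comm_group G by fact
  interpret H: group H by fact
  obtain h where h: "h \<in> iso G H" using assms(3) by (auto simp: is_iso_def)
  then have "comm_group (H \<lparr>one := h \<one>\<^bsub>G\<^esub>\<rparr>)" by (rule iso_imp_img_comm_group)
  moreover have "h \<one>\<^bsub>G\<^esub> = \<one>\<^bsub>H\<^esub>"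
    using h hom_one[of h G H] by (simp add: iso_def H.is_group)
  ultimately show ?thesis by simp
qed

lemma DirProd_cong:
  assumes "group G" "G \<cong> G'" "H \<cong> H'"
  shows "G \<times>\<times> H \<cong> G' \<times>\<times> H'"
  using group.DirProd_iso_trans assms by blast

lemma DirProd_assoc_iso: "(G \<times>\<times> H) \<times>\<times> K \<cong> G \<times>\<times> (H \<times>\<times> K)"
proof -
  have "(\<lambda>((x,y),z). (x,(y,z))) \<in> iso ((G \<times>\<times> H) \<times>\<times> K) (G \<times>\<times> (H \<times>\<times> K))"
    by (auto simp: iso_def hom_def inj_on_def bij_betw_def image_iff)
  then show ?thesis by (auto simp: is_iso_def)
qed

lemma cyclic_product_Nil_iso:
  assumes "group H"
  shows "cyclic_product [] \<times>\<times> H \<cong> H"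
proof -
  interpret group H by fact
  have "snd \<in> iso (cyclic_product [] \<times>\<times> H) H"
    by (auto simp: iso_def hom_def inj_on_def bij_betw_def cyclic_product_def mult_DirProd' image_iff)
  then show ?thesis by (auto simp: is_iso_def)
qed

lemma cyclic_product_Cons_iso:
  "cyclic_product (a # l) \<cong> integer_mod_group a \<times>\<times> cyclic_product l"
proof -
  define h :: "(nat \<Rightarrow> int) \<Rightarrow> int \<times> (nat \<Rightarrow> int)"
    where "h = (\<lambda>x. (x 0, \<lambda>i\<in>{..<length l}. x (Suc i)))"
  define k :: "int \<times> (nat \<Rightarrow> int) \<Rightarrow> nat \<Rightarrow> int"
    where "k = (\<lambda>(u, x). \<lambda>i\<in>{..<Suc (length l)}. case i of 0 \<Rightarrow> u | Suc j \<Rightarrow> x j)"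
  have nth: "x 0 \<in> carrier (integer_mod_group a)"
    "i < length l \<Longrightarrow> x (Suc i) \<in> carrier (integer_mod_group (l ! i))"
    if "\<forall>i\<in>{..<Suc (length l)}. x i \<in> carrier (integer_mod_group ((a # l) ! i))" for x i
    using bspec[OF that, of 0] bspec[OF that, of "Suc i"] by auto
  have hom: "h \<in> hom (cyclic_product (a # l)) (integer_mod_group a \<times>\<times> cyclic_product l)"
    by (rule homI) (auto simp: h_def cyclic_product_def PiE_iff intro: nth)
  have "bij_betw h (carrier (cyclic_product (a # l)))
     (carrier (integer_mod_group a \<times>\<times> cyclic_product l))"
  proof (rule bij_betw_byWitness[where f' = k])
    show "\<forall>x\<in>carrier (cyclic_product (a # l)). k (h x) = x"
      by (auto simp: h_def k_def cyclic_product_def fun_eq_iff PiE_iff extensional_def split: nat.split)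
    show "\<forall>y\<in>carrier (integer_mod_group a \<times>\<times> cyclic_product l). h (k y) = y"
      by (auto simp: h_def k_def cyclic_product_def fun_eq_iff PiE_iff extensional_def)
    show "h ` carrier (cyclic_product (a # l)) \<subseteq> carrier (integer_mod_group a \<times>\<times> cyclic_product l)"
      by (rule hom_carrier[OF hom])
    show "k ` carrier (integer_mod_group a \<times>\<times> cyclic_product l) \<subseteq> carrier (cyclic_product (a # l))"
    proof clarify
      fix u x assume "(u, x) \<in> carrier (integer_mod_group a \<times>\<times> cyclic_product l)"
      then have u: "u \<in> carrier (integer_mod_group a)"
        by simp
      have x: "x j \<in> carrier (integer_mod_group (l ! j))" if "j < length l" for j
        using that \<open>(u, x) \<in> _\<close> by (auto simp: cyclic_product_def)
      show "k (u, x) \<in> carrier (cyclic_product (a # l))"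
        unfolding cyclic_product_def carrier_product_group
      proof (rule PiE_I)
        fix i assume "i \<in> {..<length (a # l)}"
        then show "k (u, x) i \<in> carrier (integer_mod_group ((a # l) ! i))"
          using u x by (cases i) (auto simp: k_def)
      qed (simp add: k_def)
    qed
  qed
  with hom show ?thesis by (auto simp: is_iso_def iso_def)
qed

lemma cyclic_product_append_iso:
  "cyclic_product (k @ l) \<cong> cyclic_product k \<times>\<times> cyclic_product l"
proof (induction k)
  case Nil
  show ?case
    using group.iso_sym[OF _ cyclic_product_Nil_iso[of "cyclic_product l"]] by (simp add: DirProd_group)
next
  case (Cons a k)
  have "cyclic_product ((a # k) @ l) \<cong> integer_mod_group a \<times>\<times> cyclic_product (k @ l)"
    using cyclic_product_Cons_iso by simp
  also have "\<dots> \<cong> integer_mod_group a \<times>\<times> (cyclic_product k \<times>\<times> cyclic_product l)"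
    by (intro DirProd_cong Cons.IH) auto
  also have "\<dots> \<cong> (integer_mod_group a \<times>\<times> cyclic_product k) \<times>\<times> cyclic_product l"
    by (intro group.iso_sym[OF _ DirProd_assoc_iso] DirProd_group) auto
  also have "\<dots> \<cong> cyclic_product (a # k) \<times>\<times> cyclic_product l"
    by (intro DirProd_cong group.iso_sym[OF _ cyclic_product_Cons_iso] DirProd_group) auto
  finally show ?case .
qed

text \<open>The head \<open>a\<close> occurs somewhere in \<open>l\<close>; associativity and
  commutativity of direct products move it past the block \<open>u\<close> that precedes it
  there.\<close>

lemma cyclic_product_mset_iso:
  assumes "mset k = mset l"
  shows "cyclic_product k \<cong> cyclic_product l"
  using assms
proof (induction k arbitrary: l)
  case Nil
  then show ?case by simp
next
  case (Cons a k)
  then have "a \<in> set l" by (metis list.set_intros(1) set_mset_mset)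
  then obtain u v where l: "l = u @ a # v" by (meson split_list)
  with Cons.prems have "mset k = mset (u @ v)" by simp
  have "cyclic_product (a # k) \<cong> integer_mod_group a \<times>\<times> cyclic_product k"
    by (rule cyclic_product_Cons_iso)
  also have "\<dots> \<cong> integer_mod_group a \<times>\<times> cyclic_product (u @ v)"
    by (intro DirProd_cong Cons.IH) (auto simp: \<open>mset k = mset (u @ v)\<close>)
  also have "\<dots> \<cong> integer_mod_group a \<times>\<times> (cyclic_product u \<times>\<times> cyclic_product v)"
    by (intro DirProd_cong cyclic_product_append_iso) auto
  also have "\<dots> \<cong> (integer_mod_group a \<times>\<times> cyclic_product u) \<times>\<times> cyclic_product v"
    by (intro group.iso_sym[OF _ DirProd_assoc_iso] DirProd_group) auto
  also have "\<dots> \<cong> (cyclic_product u \<times>\<times> integer_mod_group a) \<times>\<times> cyclic_product v"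
    by (intro DirProd_cong DirProd_commute_iso DirProd_group) auto
  also have "\<dots> \<cong> cyclic_product u \<times>\<times> (integer_mod_group a \<times>\<times> cyclic_product v)"
    by (rule DirProd_assoc_iso)
  also have "\<dots> \<cong> cyclic_product u \<times>\<times> cyclic_product (a # v)"
    by (intro DirProd_cong group.iso_sym[OF _ cyclic_product_Cons_iso] DirProd_group) auto
  also have "\<dots> \<cong> cyclic_product l"
    unfolding l by (intro group.iso_sym[OF _ cyclic_product_append_iso]) auto
  finally show ?case .
qed

lemma cyclic_product_singleton_iso: "cyclic_product [a] \<cong> integer_mod_group a"
proof -
  have "cyclic_product [a] \<cong> integer_mod_group a \<times>\<times> cyclic_product []"
    by (rule cyclic_product_Cons_iso)
  also have "\<dots> \<cong> cyclic_product [] \<times>\<times> integer_mod_group a"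
    by (rule DirProd_commute_iso)
  also have "\<dots> \<cong> integer_mod_group a"
    by (rule cyclic_product_Nil_iso) simp
  finally show ?thesis .
qed

text \<open>A relation instead of a function, with arbitrary moduli: this way types can be added and
  transported along isomorphisms freely. Uniqueness has to wait for the restriction to prime powers,
  since for instance the moduli 6 and 2, 3 describe the same group.\<close>

definition has_type :: "('a, 'b) monoid_scheme \<Rightarrow> nat multiset \<Rightarrow> bool" where
  "has_type G M \<longleftrightarrow> group G \<and> (\<exists>l. mset l = M \<and> G \<cong> cyclic_product l)"

lemma has_type_group: "has_type G M \<Longrightarrow> group G"
  by (simp add: has_type_def)

lemma has_type_cyclic_product: "has_type (cyclic_product l) (mset l)"
  by (auto simp: has_type_def)

lemma has_type_comm_group:
  assumes "has_type G M" shows "comm_group G"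
proof -
  obtain l where "G \<cong> cyclic_product l" "group G" using assms by (auto simp: has_type_def)
  then show ?thesis
    by (meson comm_group_iso comm_group_cyclic_product group.iso_sym)
qed

lemma has_type_iso:
  assumes "has_type G M" "group H" "G \<cong> H"
  shows "has_type H M"
proof -
  obtain l where l: "mset l = M" "G \<cong> cyclic_product l" "group G"
    using assms(1) by (auto simp: has_type_def)
  then have "H \<cong> cyclic_product l" using assms(3) by (meson group.iso_sym iso_trans)
  with l assms(2) show ?thesis by (auto simp: has_type_def)
qed

lemma has_type_imp_iso:
  assumes "has_type G M" "has_type H M"
  shows "G \<cong> H"
proof -
  obtain k l where kl: "mset k = M" "mset l = M" "G \<cong> cyclic_product k" "H \<cong> cyclic_product l"
    "group H"
    using assms by (auto simp: has_type_def)
  have "cyclic_product k \<cong> cyclic_product l" using kl by (intro cyclic_product_mset_iso) simp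
  moreover have "cyclic_product l \<cong> H" using kl by (meson group.iso_sym)
  ultimately show ?thesis using kl by (meson iso_trans)
qed

lemma has_type_DirProd:
  assumes "has_type G A" "has_type H B"
  shows "has_type (G \<times>\<times> H) (A + B)"
proof -
  obtain k l where kl: "mset k = A" "mset l = B" "G \<cong> cyclic_product k" "H \<cong> cyclic_product l"
    "group G" "group H"
    using assms by (auto simp: has_type_def)
  have "G \<times>\<times> H \<cong> cyclic_product k \<times>\<times> cyclic_product l" using kl by (intro DirProd_cong)
  also have "\<dots> \<cong> cyclic_product (k @ l)"
    by (rule group.iso_sym[OF _ cyclic_product_append_iso]) simp
  finally show ?thesis
    unfolding has_type_def using kl by (auto intro!: DirProd_group exI[of _ "k @ l"])
qed

lemma has_type_integer_mod_group: "has_type (integer_mod_group q) {#q#}"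
  by (rule has_type_iso[OF has_type_cyclic_product[of "[q]", simplified]])
     (auto simp: cyclic_product_singleton_iso)

subsection \<open>Counting torsion\<close>

text \<open>The invariant that separates types and later identifies the primary components.\<close>

definition torsion_card :: "('a, 'b) monoid_scheme \<Rightarrow> nat \<Rightarrow> nat" where
  "torsion_card G d = card {x \<in> carrier G. x [^]\<^bsub>G\<^esub> d = \<one>\<^bsub>G\<^esub>}"

lemma torsion_card_iso:
  assumes "group G" "group H" "G \<cong> H"
  shows "torsion_card G d = torsion_card H d"
proof -
  interpret G: group G by fact
  interpret H: group H by fact
  obtain h where h: "h \<in> iso G H" using assms(3) by (auto simp: is_iso_def)
  interpret group_hom G H h
    using h by unfold_locales (simp add: iso_def)
  have bij: "bij_betw h (carrier G) (carrier H)" using h by (simp add: iso_def)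
  have eq: "h x [^]\<^bsub>H\<^esub> d = \<one>\<^bsub>H\<^esub> \<longleftrightarrow> x [^]\<^bsub>G\<^esub> d = \<one>\<^bsub>G\<^esub>" if "x \<in> carrier G" for x
  proof -
    have "h x [^]\<^bsub>H\<^esub> d = \<one>\<^bsub>H\<^esub> \<longleftrightarrow> h (x [^]\<^bsub>G\<^esub> d) = h \<one>\<^bsub>G\<^esub>"
      using that by (simp add: hom_nat_pow)
    also have "\<dots> \<longleftrightarrow> x [^]\<^bsub>G\<^esub> d = \<one>\<^bsub>G\<^esub>"
      using that by (intro inj_on_eq_iff[OF bij_betw_imp_inj_on[OF bij]]) auto
    finally show ?thesis .
  qed
  have "bij_betw h {x \<in> carrier G. x [^]\<^bsub>G\<^esub> d = \<one>\<^bsub>G\<^esub>} {x \<in> carrier H. x [^]\<^bsub>H\<^esub> d = \<one>\<^bsub>H\<^esub>}"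
    unfolding bij_betw_def
  proof
    show "inj_on h {x \<in> carrier G. x [^]\<^bsub>G\<^esub> d = \<one>\<^bsub>G\<^esub>}"
      using bij_betw_imp_inj_on[OF bij] by (rule inj_on_subset) auto
    show "h ` {x \<in> carrier G. x [^]\<^bsub>G\<^esub> d = \<one>\<^bsub>G\<^esub>} = {x \<in> carrier H. x [^]\<^bsub>H\<^esub> d = \<one>\<^bsub>H\<^esub>}"
    proof (intro equalityI subsetI)
      fix y assume y: "y \<in> {x \<in> carrier H. x [^]\<^bsub>H\<^esub> d = \<one>\<^bsub>H\<^esub>}"
      then obtain x where "x \<in> carrier G" "y = h x"
        using bij_betw_imp_surj_on[OF bij] by blast
      then show "y \<in> h ` {x \<in> carrier G. x [^]\<^bsub>G\<^esub> d = \<one>\<^bsub>G\<^esub>}"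
        using y eq[of x] by blast
    qed (use eq in auto)
  qed
  then show ?thesis unfolding torsion_card_def by (rule bij_betw_same_card)
qed

lemma pow_product_group:
  assumes "\<And>i. i \<in> I \<Longrightarrow> group (G i)" "x \<in> carrier (product_group I G)"
  shows "x [^]\<^bsub>product_group I G\<^esub> (n::nat) = (\<lambda>i\<in>I. x i [^]\<^bsub>G i\<^esub> n)"
proof (induction n)
  case 0
  then show ?case by simp
next
  case (Suc n)
  then show ?case by (auto simp: fun_eq_iff)
qed

text \<open>With \<open>g = gcd d q\<close>, the solutions are exactly the multiples of
  \<open>q div g\<close>, and \<open>g\<close> of them lie in the range.\<close>

lemma card_multiples_mod:
  fixes q d :: nat
  assumes "q > 0"
  shows "card {x \<in> {0..<int q}. (int d * x) mod int q = 0} = gcd d q"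
proof -
  define g where "g = gcd d q"
  have g: "g > 0" "g dvd q" "g dvd d" using assms by (auto simp: g_def)
  define m where "m = q div g"
  have q: "q = g * m" using g by (simp add: m_def)
  obtain e where d: "d = g * e" using g by blast
  have "m > 0" using q assms by (cases m) auto
  have cop: "coprime m e"
  proof -
    have "g = gcd (g * e) (g * m)" using g_def q d by simp
    also have "\<dots> = g * gcd e m" by (simp add: gcd_mult_distrib_nat)
    finally have "gcd e m = 1" using g by simp
    then show ?thesis by (simp add: coprime_iff_gcd_eq_1 gcd.commute)
  qed
  have "{x \<in> {0..<int q}. (int d * x) mod int q = 0} = (\<lambda>i. int (i * m)) ` {0..<g}" (is "?L = ?R")
  proof (intro equalityI subsetI)
    fix x assume x: "x \<in> ?L"
    then have x0: "0 \<le> x" "x < int q" by auto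
    define y where "y = nat x"
    have y: "x = int y" "y < q" using x0 by (auto simp: y_def)
    have "int q dvd int d * x" using x by auto
    then have "q dvd d * y" using y by (metis int_dvd_int_iff of_nat_mult)
    then have "g * m dvd g * (e * y)" by (simp add: q d mult.assoc)
    then have "m dvd e * y" using g by simp
    then have "m dvd y" using cop by (simp add: coprime_dvd_mult_right_iff)
    then obtain i where i: "y = i * m" by (metis dvdE mult.commute)
    with y q have "i < g" by simp
    with i y show "x \<in> ?R" by auto
  next
    fix x assume "x \<in> ?R"
    then obtain i where i: "i < g" "x = int (i * m)" by auto
    have "i * m < q" unfolding q using i \<open>m > 0\<close> by simp
    moreover have "int d * x = int q * int (e * i)" by (simp add: i q d)
    ultimately show "x \<in> ?L" using i by (simp del: of_nat_mult)
  qed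
  moreover have "inj_on (\<lambda>i. int (i * m)) {0..<g}" using \<open>m > 0\<close> by (auto simp: inj_on_def)
  ultimately show ?thesis by (simp add: card_image g_def del: of_nat_mult)
qed

text \<open>The torsion condition can be checked in each coordinate separately. A modulus 0 would
  stand for the infinite cyclic group, where the gcd formula fails in general.\<close>

lemma torsion_card_cyclic_product:
  assumes "0 \<notin> set l"
  shows "torsion_card (cyclic_product l) d = (\<Prod>q\<in>#mset l. gcd d q)"
proof -
  have pos: "l ! i > 0" if "i < length l" for i
    using assms that nth_mem[of i l] by (auto simp del: nth_mem intro!: gr0I)
  have "{x \<in> carrier (cyclic_product l). x [^]\<^bsub>cyclic_product l\<^esub> d = \<one>\<^bsub>cyclic_product l\<^esub>} =
      (\<Pi>\<^sub>E i\<in>{..<length l}. {x \<in> {0..<int (l ! i)}. (int d * x) mod int (l ! i) = 0})"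
    (is "?L = ?R")
  proof (intro equalityI subsetI)
    fix x assume x: "x \<in> ?L"
    then have xc: "x \<in> carrier (product_group {..<length l} (\<lambda>i. integer_mod_group (l ! i)))"
      by (simp add: cyclic_product_def)
    have "(\<lambda>i\<in>{..<length l}. x i [^]\<^bsub>integer_mod_group (l!i)\<^esub> d) = (\<lambda>i\<in>{..<length l}. 0)"
      using x pow_product_group[OF _ xc] by (simp add: cyclic_product_def)
    then have "(int d * x i) mod int (l ! i) = 0" if "i < length l" for i
      using that by (auto simp: fun_eq_iff split: if_splits)
    with xc pos show "x \<in> ?R" by (auto simp: PiE_iff carrier_integer_mod_group split: if_splits)
  next
    fix x assume x: "x \<in> ?R"
    then have xc: "x \<in> carrier (product_group {..<length l} (\<lambda>i. integer_mod_group (l ! i)))"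
      using pos by (auto simp: PiE_iff carrier_integer_mod_group)
    with x show "x \<in> ?L"
      using pow_product_group[OF _ xc] by (auto simp: cyclic_product_def PiE_iff)
  qed
  then have "torsion_card (cyclic_product l) d =
      (\<Prod>i<length l. card {x \<in> {0..<int (l ! i)}. (int d * x) mod int (l ! i) = 0})"
    by (simp add: torsion_card_def card_PiE)
  also have "\<dots> = (\<Prod>i<length l. gcd d (l ! i))"
    using pos by (intro prod.cong refl card_multiples_mod) auto
  also have "\<dots> = prod_list (map (gcd d) l)"
    by (simp add: prod.list_conv_set_nth atLeast0LessThan)
  finally show ?thesis by (simp add: prod_mset_prod_list flip: mset_map)
qed

lemma torsion_card_has_type:
  assumes "has_type G M" "0 \<notin># M"
  shows "torsion_card G d = (\<Prod>q\<in>#M. gcd d q)"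
proof -
  obtain l where "mset l = M" "G \<cong> cyclic_product l" "group G" using assms by (auto simp: has_type_def)
  then show ?thesis
    using torsion_card_iso[of G "cyclic_product l"] torsion_card_cyclic_product[of l] assms by auto
qed

lemma order_has_type:
  assumes "has_type G M" "0 \<notin># M"
  shows "finite (carrier G)" "order G = \<Prod>\<^sub># M"
proof -
  obtain l where l: "mset l = M" "G \<cong> cyclic_product l" "group G" using assms by (auto simp: has_type_def)
  have pos: "l ! i > 0" if "i < length l" for i
    using assms l that nth_mem[of i l] by (auto simp del: nth_mem intro!: gr0I)
  have "carrier (cyclic_product l) = (\<Pi>\<^sub>E i\<in>{..<length l}. {0..<int (l ! i)})"
    using pos by (auto simp: cyclic_product_def carrier_integer_mod_group PiE_iff split: if_splits)
  then have fin: "finite (carrier (cyclic_product l))"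
    and card: "card (carrier (cyclic_product l)) = (\<Prod>i<length l. l ! i)"
    by (auto simp: card_PiE intro!: finite_PiE)
  show "finite (carrier G)" using fin l iso_finite by blast
  have "order G = (\<Prod>i<length l. l ! i)" using l iso_same_card card by (metis order_def)
  also have "\<dots> = prod_list l" by (simp add: prod.list_conv_set_nth atLeast0LessThan)
  finally show "order G = \<Prod>\<^sub># M" using l by (simp add: prod_mset_prod_list flip: l(1))
qed

section \<open>Recovering a multiset of prime powers from its gcd products\<close>

lemma primepow_nat_dvd_cases:
  fixes q :: nat
  assumes "primepow q" "prime p" "p ^ j dvd q" "j > 0"
  obtains i where "i \<ge> j" "q = p ^ i"
proof -
  obtain p' k where q: "prime p'" "k > 0" "q = p' ^ k"
    using assms(1) by (auto simp: primepow_def)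
  have "p dvd p' ^ k" using assms q by (metis dvd_power dvd_trans)
  then have "p = p'" using assms q by (metis prime_dvd_power primes_dvd_imp_eq)
  then have "p ^ j dvd p ^ k" using assms q by simp
  then have "j \<le> k" using \<open>p = p'\<close> q by (metis power_dvd_imp_le prime_gt_1_nat)
  then show ?thesis using that \<open>p = p'\<close> q by blast
qed

text \<open>A power of another prime gives 1 on both sides. For \<open>q = p ^ k\<close> the gcd
  with \<open>p ^ j\<close> is \<open>p ^ min j k\<close>, which grows only as long as
  \<open>j < k\<close>.\<close>

lemma gcd_prime_power_step:
  fixes q :: nat
  assumes "prime p" "primepow q"
  shows "gcd (p ^ Suc j) q = gcd (p ^ j) q * (if p ^ Suc j dvd q then p else 1)"
proof -
  obtain p' k where q: "prime p'" "k > 0" "q = p' ^ k"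
    using assms(2) by (auto simp: primepow_def)
  show ?thesis
  proof (cases "p = p'")
    case False
    then have "coprime p p'" using assms q by (simp add: primes_coprime)
    then have cop: "coprime (p ^ i) q" for i using q by simp
    have "\<not> p ^ Suc j dvd q"
      using cop[of "Suc j"] assms
      by (metis coprime_absorb_left is_unit_power_iff not_prime_unit zero_less_Suc not_gr0)
    then show ?thesis using cop[of j] cop[of "Suc j"] by (simp add: coprime_iff_gcd_eq_1 del: power_Suc)
  next
    case True
    have le: "p ^ i dvd q \<longleftrightarrow> i \<le> k" for i
      using True q by (metis le_imp_power_dvd power_dvd_imp_le prime_gt_1_nat)
    have g: "gcd (p ^ i) q = p ^ min i k" for i
    proof (cases "i \<le> k")
      case True
      then show ?thesis using le[of i] by (simp add: gcd_nat.absorb1 min_def)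
    next
      case False
      then have "q dvd p ^ i" using True q by (simp add: le_imp_power_dvd)
      then show ?thesis using False True q by (simp add: gcd_nat.absorb2 min_def)
    qed
    show ?thesis
    proof (cases "Suc j \<le> k")
      case False
      then have "min (Suc j) k = k" "min j k = k" by auto
      then show ?thesis unfolding g le using False by simp
    qed (simp add: g le min_def del: power_Suc, simp)
  qed
qed

text \<open>Two differences recover the multiplicities. The quotient of the products for consecutive
  powers of \<open>p\<close> is \<open>p\<close> to the number of entries divisible by the higher
  power. Among prime powers, those divisible by \<open>p ^ Suc j\<close> are the
  \<open>p ^ i\<close> with \<open>i \<ge> Suc j\<close>, so the difference of consecutive numbers
  is the multiplicity of \<open>p ^ Suc j\<close>.\<close>

lemma prime_power_mset_eqI:
  fixes A B :: "nat multiset"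
  assumes A: "\<And>q. q \<in># A \<Longrightarrow> primepow q" and B: "\<And>q. q \<in># B \<Longrightarrow> primepow q"
    and eq: "\<And>p j. prime p \<Longrightarrow> (\<Prod>q\<in>#A. gcd (p ^ j) q) = (\<Prod>q\<in>#B. gcd (p ^ j) q)"
  shows "A = B"
proof -
  define c where "c = (\<lambda>(M :: nat multiset) d. size (filter_mset (\<lambda>q. d dvd q) M))"
  have prod_step: "(\<Prod>q\<in>#M. gcd (p ^ Suc j) q) = (\<Prod>q\<in>#M. gcd (p ^ j) q) * p ^ c M (p ^ Suc j)"
    if "prime p" "\<And>q. q \<in># M \<Longrightarrow> primepow q" for M :: "nat multiset" and p j
  proof -
    define d where "d = p ^ Suc j"
    have step: "gcd d q = gcd (p ^ j) q * (if d dvd q then p else 1)" if "q \<in># M" for q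
      unfolding d_def using \<open>prime p\<close> \<open>\<And>q. q \<in># M \<Longrightarrow> primepow q\<close>[OF that]
      by (rule gcd_prime_power_step)
    have "(\<Prod>q\<in>#M. gcd d q) = (\<Prod>q\<in>#M. gcd (p ^ j) q) * p ^ c M d"
      using step by (induction M) (auto simp: c_def)
    then show ?thesis by (simp only: d_def)
  qed
  have cpow: "c A (p ^ Suc j) = c B (p ^ Suc j)" if "prime p" for p j
  proof -
    have pos: "(\<Prod>q\<in>#B. gcd (p ^ j) q) > 0"
      using prime_gt_0_nat[OF that] by (auto simp: image_iff intro!: gr0I)
    have "(\<Prod>q\<in>#B. gcd (p ^ j) q) * p ^ c A (p ^ Suc j) = (\<Prod>q\<in>#B. gcd (p ^ j) q) * p ^ c B (p ^ Suc j)"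
      using prod_step[OF that A, of A j] prod_step[OF that B, of B j] eq[OF that, of j] eq[OF that, of "Suc j"]
      by simp
    then have "p ^ c A (p ^ Suc j) = p ^ c B (p ^ Suc j)"
      using pos by (metis mult_cancel1 less_numeral_extra(3))
    then show ?thesis using prime_gt_1_nat[OF that] by (simp add: power_inject_exp del: power_Suc)
  qed
  have count_eq: "count M (p ^ Suc j) + c M (p ^ Suc (Suc j)) = c M (p ^ Suc j)"
    if "prime p" "\<And>q. q \<in># M \<Longrightarrow> primepow q" for M :: "nat multiset" and p j
    using that(2)
  proof (induction M)
    case empty
    then show ?case by (simp add: c_def)
  next
    case (add q M)
    have "primepow q" using add.prems by simp
    have p1: "p > 1" using that(1) by (rule prime_gt_1_nat)
    have "(if q = p ^ Suc j then 1 else 0) + (if p ^ Suc (Suc j) dvd q then 1 else 0) =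
        (if p ^ Suc j dvd q then 1 else (0::nat))"
    proof (cases "p ^ Suc j dvd q")
      case True
      then obtain i where i: "i \<ge> Suc j" "q = p ^ i"
        using primepow_nat_dvd_cases[OF \<open>primepow q\<close> \<open>prime p\<close>, of "Suc j"] by blast
      have d: "p ^ a dvd p ^ b \<longleftrightarrow> a \<le> b" for a b
        using p1 by (metis le_imp_power_dvd power_dvd_imp_le)
      show ?thesis unfolding i d using p1 i(1) by (auto simp: power_inject_exp simp del: power_Suc)
    next
      case False
      then have "\<not> p ^ Suc (Suc j) dvd q" by (meson dvd_trans le_imp_power_dvd lessI less_imp_le)
      then show ?thesis using False by auto
    qed
    moreover have "count M (p ^ Suc j) + c M (p ^ Suc (Suc j)) = c M (p ^ Suc j)"
      using add by simp
    ultimately show ?case by (auto simp: c_def simp del: power_Suc split: if_splits)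
  qed
  show ?thesis
  proof (rule multiset_eqI)
    fix q
    show "count A q = count B q"
    proof (cases "primepow q")
      case True
      then obtain p k where q: "prime p" "k > 0" "q = p ^ k" by (auto simp: primepow_def)
      then obtain j where "k = Suc j" by (cases k) auto
      then show ?thesis
        using count_eq[OF q(1) A, of A j] count_eq[OF q(1) B, of B j] cpow[OF q(1), of j]
          cpow[OF q(1), of "Suc j"] q by (simp del: power_Suc)
    next
      case False
      then show ?thesis using A B by (metis count_eq_zero_iff)
    qed
  qed
qed

lemma has_type_unique:
  assumes "has_type G A" "has_type G B"
    and "\<And>q. q \<in># A \<Longrightarrow> primepow q" "\<And>q. q \<in># B \<Longrightarrow> primepow q"
  shows "A = B"
proof (rule prime_power_mset_eqI)
  fix p j :: nat
  have "0 \<notin># A" "0 \<notin># B" using assms(3,4) by (metis zero_not_primepow)+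
  then show "(\<Prod>q\<in>#A. gcd (p ^ j) q) = (\<Prod>q\<in>#B. gcd (p ^ j) q)"
    using torsion_card_has_type[OF assms(1)] torsion_card_has_type[OF assms(2)] by metis
qed (use assms in auto)

subsection \<open>Every finite abelian group is a product of cyclic groups\<close>

context comm_group
begin

lemma internal_direct_product_iso:
  assumes "subgroup A G" "subgroup B G" "A \<inter> B \<subseteq> {\<one>}" "A <#> B = carrier G"
  shows "G\<lparr>carrier := A\<rparr> \<times>\<times> G\<lparr>carrier := B\<rparr> \<cong> G"
proof -
  interpret group_disjoint_sum G A B
    using assms by (simp add: group_disjoint_sum_def is_group)
  have "(\<lambda>(x, y). x \<otimes> y) \<in> iso (subgroup_generated G A \<times>\<times> subgroup_generated G B) G"
    using iso_group_mul[OF comm_group_axioms] assms by simp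
  moreover have "subgroup_generated G H = G\<lparr>carrier := H\<rparr>" if "subgroup H G" for H
    using that subgroup.carrier_subgroup_generated_subgroup[OF that]
    by (simp add: subgroup_generated_def carrier_subgroup_generated)
  ultimately show ?thesis using assms by (auto simp: is_iso_def)
qed

lemma subgroup_torsion: "subgroup {x \<in> carrier G. x [^] (n::nat) = \<one>} G"
  by (rule subgroupI) (auto simp: nat_pow_inv nat_pow_distrib intro!: exI[of _ \<one>])

text \<open>By Bezout \<open>u * a + v * b = 1\<close>, so \<open>x\<close> is the product of its
  power with exponent \<open>v * b\<close>, which \<open>a\<close> kills, and its power with
  exponent \<open>u * a\<close>, which \<open>b\<close> kills. An element of the intersection has an
  order dividing both \<open>a\<close> and \<open>b\<close>.\<close>

lemma coprime_torsion_decomposition: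
  assumes "coprime a b" and "\<And>x. x \<in> carrier G \<Longrightarrow> x [^] (a * b) = \<one>"
  defines "A \<equiv> {x \<in> carrier G. x [^] (a::nat) = \<one>}" and "B \<equiv> {x \<in> carrier G. x [^] (b::nat) = \<one>}"
  shows "A \<inter> B \<subseteq> {\<one>}" "A <#> B = carrier G"
proof -
  show "A \<inter> B \<subseteq> {\<one>}"
  proof
    fix x assume x: "x \<in> A \<inter> B"
    then have "ord x dvd a" "ord x dvd b" by (auto simp: A_def B_def pow_eq_id)
    then have "ord x = 1" using assms(1) coprime_common_divisor_nat by blast
    then show "x \<in> {\<one>}" using x ord_eq_1 by (auto simp: A_def)
  qed
  show "A <#> B = carrier G"
  proof
    show "A <#> B \<subseteq> carrier G" by (intro set_mult_closed) (auto simp: A_def B_def)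
    show "carrier G \<subseteq> A <#> B"
    proof
      fix x assume x: "x \<in> carrier G"
      have "coprime (int a) (int b)" using assms(1) by simp
      then obtain u v where uv: "u * int a + v * int b = 1"
        by (metis bezout_int coprime_iff_gcd_eq_1)
      have ab: "x [^] (int (a * b) * k) = \<one>" for k :: int
        using x assms(2)[OF x] int_pow_pow[of x "int (a * b)" k] by (simp add: int_pow_int del: of_nat_mult)
      have "(x [^] (v * int b)) [^] int a = \<one>"
        using x ab[of v] by (simp add: int_pow_pow mult_ac)
      then have 1: "x [^] (v * int b) \<in> A" using x by (simp add: A_def int_pow_int)
      have "(x [^] (u * int a)) [^] int b = \<one>"
        using x ab[of u] by (simp add: int_pow_pow mult_ac)
      then have 2: "x [^] (u * int a) \<in> B" using x by (simp add: B_def int_pow_int)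
      have "x = x [^] (v * int b) \<otimes> x [^] (u * int a)"
        using x uv by (simp add: int_pow_mult[symmetric] add.commute)
      then show "x \<in> A <#> B" using 1 2 by (auto simp: set_mult_def)
    qed
  qed
qed

lemma cyclic_subgroup_iso:
  assumes "x \<in> carrier G" "ord x > 0"
  shows "G\<lparr>carrier := generate G {x}\<rparr> \<cong> integer_mod_group (ord x)"
proof -
  define n where "n = ord x"
  have "n > 0" using assms by (simp add: n_def)
  have eq: "x [^] (i :: int) = x [^] j \<longleftrightarrow> i mod int n = j mod int n" for i j
    using int_pow_eq[OF assms(1), of i j] by (simp add: n_def mod_eq_dvd_iff dvd_diff_commute)
  have hom: "(\<lambda>k::int. x [^] k) \<in> hom (integer_mod_group n) (G\<lparr>carrier := generate G {x}\<rparr>)"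
    using assms by (intro homI) (auto simp: generate_pow eq int_pow_mult[symmetric])
  have "inj_on (\<lambda>k::int. x [^] k) {0..<int n}"
    by (auto simp: inj_on_def eq)
  moreover have "(\<lambda>k::int. x [^] k) ` {0..<int n} = generate G {x}"
  proof (intro equalityI subsetI)
    fix y assume "y \<in> generate G {x}"
    then obtain k :: int where "y = x [^] k" using assms by (auto simp: generate_pow)
    then have "y = x [^] (k mod int n)" by (simp add: eq)
    then show "y \<in> (\<lambda>k::int. x [^] k) ` {0..<int n}" using \<open>n > 0\<close> by auto
  qed (use assms in \<open>auto simp: generate_pow\<close>)
  ultimately have "bij_betw (\<lambda>k::int. x [^] k) (carrier (integer_mod_group n)) (generate G {x})"
    using \<open>n > 0\<close> by (simp add: bij_betw_def carrier_integer_mod_group)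
  with hom have "integer_mod_group n \<cong> G\<lparr>carrier := generate G {x}\<rparr>"
    by (auto simp: is_iso_def iso_def)
  then show ?thesis unfolding n_def by (rule group.iso_sym[OF group_integer_mod_group])
qed

text \<open>The complement \<open>K\<close> is a subgroup maximal among those meeting the cyclic subgroup trivially.\<close>
lemma cyclic_complement:
  assumes fin: "finite (carrier G)" and p: "prime (p::nat)" and x: "x \<in> carrier G"
    and ord: "ord x = p ^ e" "e > 0"
    and exp: "\<And>y. y \<in> carrier G \<Longrightarrow> y [^] (p ^ e) = \<one>"
  obtains K where "subgroup K G" "generate G {x} \<inter> K \<subseteq> {\<one>}" "generate G {x} <#> K = carrier G"
proof -
  define X where "X = generate G {x}"
  have X: "X = {x [^] (k::int) | k. k \<in> UNIV}" unfolding X_def using x by (rule generate_pow)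
  have subX: "subgroup X G" unfolding X_def using x by (intro generate_is_subgroup) auto
  define S where "S = {K. subgroup K G \<and> X \<inter> K \<subseteq> {\<one>}}"
  have "finite S"
    by (rule finite_subset[of _ "Pow (carrier G)"]) (auto simp: S_def fin dest: subgroup.subset)
  moreover have "{\<one>} \<in> S" by (auto simp: S_def triv_subgroup)
  ultimately obtain K where K: "K \<in> S" and max: "\<And>K'. K' \<in> S \<Longrightarrow> card K' \<le> card K"
    using Max_in[of "card ` S"] Max_ge[of "card ` S"] by (smt (verit) emptyE empty_is_image finite_imageI imageE image_eqI)
  have subK: "subgroup K G" and XK: "X \<inter> K \<subseteq> {\<one>}" using K by (auto simp: S_def)
  note Kc = subgroup.mem_carrier[OF subK]
  define H where "H = X <#> K"
  have subH: "subgroup H G" unfolding H_def by (rule mult_subgroups[OF subX subK])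
  have XH: "X \<subseteq> H" and KH: "K \<subseteq> H"
    using subgroup.one_closed[OF subX] subgroup.one_closed[OF subK] subgroup.mem_carrier[OF subX] Kc
    by (force simp: H_def set_mult_def)+
  have "carrier G \<subseteq> H"
  proof (rule ccontr)
    assume "\<not> carrier G \<subseteq> H"
    then obtain y0 where y0: "y0 \<in> carrier G" "y0 \<notin> H" by blast
    \<comment> \<open>The last power of \<open>y0\<close> outside \<open>H\<close> will serve as
      \<open>y\<close>: it is not in \<open>H\<close>, but its \<open>p\<close>-th power is.\<close>
    define k where "k = (LEAST k. y0 [^] (p ^ k) \<in> H)"
    have ex: "y0 [^] (p ^ e) \<in> H" using exp[OF y0(1)] subgroup.one_closed[OF subH] by simp
    have k: "y0 [^] (p ^ k) \<in> H" unfolding k_def by (rule LeastI[of _ e]) (rule ex)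
    have "k \<noteq> 0" using k y0 by (intro notI) simp
    then obtain k' where k': "k = Suc k'" by (cases k) auto
    define y where "y = y0 [^] (p ^ k')"
    have yc: "y \<in> carrier G" using y0 by (simp add: y_def)
    have yH: "y \<notin> H" using not_less_Least[of k' "\<lambda>k. y0 [^] (p ^ k) \<in> H"] k' by (simp add: k_def y_def)
    have "y [^] p \<in> H" using k y0 by (simp add: y_def nat_pow_pow k' mult.commute)
    then obtain a :: int and \<kappa> where a: "\<kappa> \<in> K" "y [^] p = x [^] a \<otimes> \<kappa>"
      by (auto simp: H_def set_mult_def X)
    have \<kappa>c: "\<kappa> \<in> carrier G" using a Kc by blast
    \<comment> \<open>Raising the equation for the \<open>p\<close>-th power of \<open>y\<close> to
      the power \<open>q\<close> gives the identity, because \<open>p * q\<close> is an exponent of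
      the group. Hence the power of \<open>x\<close> with exponent \<open>a * q\<close> lies in both
      \<open>X\<close> and \<open>K\<close>, is trivial, and \<open>p\<close> divides
      \<open>a\<close>.\<close>
    define q where "q = p ^ (e - 1)"
    have pe: "p ^ e = p * q" using ord(2) by (cases e) (auto simp: q_def)
    have "(x [^] a \<otimes> \<kappa>) [^] q = \<one>"
      using exp[OF yc] yc by (simp add: a(2)[symmetric] nat_pow_pow pe)
    then have "(x [^] a) [^] q \<otimes> \<kappa> [^] q = \<one>" using x \<kappa>c by (simp add: nat_pow_distrib)
    then have "(x [^] a) [^] q = inv (\<kappa> [^] q)" using x \<kappa>c by (metis inv_equality int_pow_closed nat_pow_closed)
    moreover have "inv (\<kappa> [^] q) \<in> K"
      using a subK by (metis subgroup.m_inv_closed int_pow_int subgroup_int_pow_closed)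
    moreover have xa: "(x [^] a) [^] q = x [^] (a * int q)"
      using x int_pow_pow[of x a "int q"] by (simp add: int_pow_int)
    ultimately have "x [^] (a * int q) \<in> K" by simp
    then have "x [^] (a * int q) = \<one>" using XK by (auto simp: X)
    then have "int (p ^ e) dvd a * int q" using x ord by (simp add: int_pow_eq_id)
    then have "int p * int q dvd a * int q" by (simp add: pe)
    moreover have "q > 0" using prime_gt_0_nat[OF p] by (simp add: q_def)
    ultimately obtain b where b: "a = int p * b" by auto
    \<comment> \<open>Dividing \<open>y\<close> by a \<open>p\<close>-th root of the
      \<open>X\<close>-part of its \<open>p\<close>-th power leaves an element outside
      \<open>H\<close> whose \<open>p\<close>-th power is \<kappa>, so lies in
      \<open>K\<close>.\<close>
    define z where "z = y \<otimes> inv (x [^] b)"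
    have zc: "z \<in> carrier G" using yc x by (simp add: z_def)
    have yz: "y = z \<otimes> x [^] b" using yc x by (simp add: z_def m_assoc)
    have zH: "z \<notin> H"
      using yz yH XH subgroup.m_closed[OF subH] by (auto simp: X)
    have "(x [^] b) [^] p = x [^] a"
      using x int_pow_pow[of x b "int p"] by (simp add: int_pow_int b mult.commute)
    then have "z [^] p \<otimes> x [^] a = \<kappa> \<otimes> x [^] a"
      using zc x a(2) \<kappa>c by (simp add: yz nat_pow_distrib m_comm)
    then have zp: "z [^] p \<in> K" using zc x \<kappa>c a(1) by simp
    define Z where "Z = generate G {z}"
    have Z: "Z = {z [^] (k::int) | k. k \<in> UNIV}" unfolding Z_def using zc by (rule generate_pow)
    have subZ: "subgroup Z G" unfolding Z_def using zc by (intro generate_is_subgroup) auto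
    have "K <#> Z \<in> S"
      unfolding S_def
    proof (intro CollectI conjI subsetI)
      show "subgroup (K <#> Z) G" by (rule mult_subgroups[OF subK subZ])
      fix w assume w: "w \<in> X \<inter> (K <#> Z)"
      then obtain \<kappa>' and j :: int where w': "\<kappa>' \<in> K" "w = \<kappa>' \<otimes> z [^] j"
        by (auto simp: set_mult_def Z)
      note \<kappa>'c = Kc[OF w'(1)]
      \<comment> \<open>Otherwise Bezout writes \<open>z\<close> through its \<open>p\<close>-th and
        \<open>j\<close>-th powers, both of which lie in \<open>H\<close>.\<close>
      have pj: "int p dvd j"
      proof (rule ccontr)
        assume "\<not> int p dvd j"
        then have "coprime (int p) j" using p by (simp add: prime_imp_coprime)
        then obtain u v where uv: "u * int p + v * j = 1" by (metis bezout_int coprime_iff_gcd_eq_1)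
        have "z [^] j = inv \<kappa>' \<otimes> w" unfolding w'(2) using \<kappa>'c zc by (simp add: m_assoc[symmetric])
        moreover have "inv \<kappa>' \<in> H" using subgroup.m_inv_closed[OF subK w'(1)] KH by blast
        moreover have "w \<in> H" using w XH by blast
        ultimately have 1: "z [^] j \<in> H" using subgroup.m_closed[OF subH] by simp
        have 2: "z [^] int p \<in> H" using zp KH by (auto simp: int_pow_int)
        have "z = (z [^] int p) [^] u \<otimes> (z [^] j) [^] v"
          using zc uv by (simp add: int_pow_pow int_pow_mult[symmetric] mult.commute)
        then have "z \<in> H"
          using subgroup.m_closed[OF subH] subgroup_int_pow_closed[OF subH] 1 2 by metis
        then show False using zH by simp
      qed
      then obtain i where "j = int p * i" by auto
      then have "z [^] j = (z [^] p) [^] i" using zc int_pow_pow[of z "int p" i] by (simp add: int_pow_int)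
      then have "w \<in> K" using w' zp subgroup.m_closed[OF subK] subgroup_int_pow_closed[OF subK] by metis
      then show "w \<in> {\<one>}" using w XK by blast
    qed
    then have "card (K <#> Z) \<le> card K" by (rule max)
    moreover have "K \<subset> K <#> Z"
    proof
      show "K \<subseteq> K <#> Z"
        using subgroup.one_closed[OF subZ] Kc by (force simp: set_mult_def)
      have "z \<in> K <#> Z"
        using subgroup.one_closed[OF subK] zc unfolding set_mult_def Z
        by (auto intro!: exI[of _ "1::int"] bexI[of _ \<one>])
      then show "K \<noteq> K <#> Z" using zH KH by blast
    qed
    moreover have "finite (K <#> Z)"
      using fin mult_subgroups[OF subK subZ] by (meson finite_subset subgroup.subset)
    ultimately show False using psubset_card_mono by (metis leD)
  qed
  then have "X <#> K = carrier G" using subgroup.subset[OF subH] by (auto simp: H_def)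
  then show ?thesis using that subK XK unfolding X_def by blast
qed

lemma has_type_internal_direct_product:
  assumes "subgroup A G" "subgroup B G" "A \<inter> B \<subseteq> {\<one>}" "A <#> B = carrier G"
    and "has_type (G\<lparr>carrier := A\<rparr>) M" "has_type (G\<lparr>carrier := B\<rparr>) N"
  shows "has_type G (M + N)"
  by (rule has_type_iso[OF has_type_DirProd[OF assms(5,6)] is_group internal_direct_product_iso[OF assms(1-4)]])

end

lemma comm_group_subgroup:
  assumes "comm_group G" "subgroup H G"
  shows "comm_group (G\<lparr>carrier := H\<rparr>)"
proof -
  interpret comm_group G by fact
  show ?thesis
    by (rule group.group_comm_groupI[OF subgroup_imp_group[OF assms(2)]])
       (auto intro: m_comm subgroup.mem_carrier[OF assms(2)])
qed

text \<open>Induction on the order. In a nontrivial \<open>p\<close>-group all orders are powers of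
  \<open>p\<close>, so the largest one is an exponent of the group, as
  \<open>cyclic_complement\<close> demands. Otherwise a prime \<open>p\<close> dividing the order of
  some element is chosen: that element is not killed by the part \<open>b\<close> of the group order
  prime to \<open>p\<close>, and some \<open>y\<close> is killed by no power of \<open>p\<close>, so
  both torsion subgroups are proper.\<close>

theorem has_type_exists:
  fixes G :: "('a, 'b) monoid_scheme"
  assumes "comm_group G" "finite (carrier G)"
  shows "\<exists>M. (\<forall>q\<in>#M. primepow q) \<and> has_type G M"
  using assms
proof (induction "card (carrier G)" arbitrary: G rule: less_induct)
  case less
  interpret comm_group G by fact
  note fin = less.prems(2)
  have ord_pos: "ord y > 0" if "y \<in> carrier G" for y
    using ord_ge_1[OF fin that] by simp
  have IH: "\<exists>M. (\<forall>q\<in>#M. primepow q) \<and> has_type (G\<lparr>carrier := A\<rparr>) M"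
    if "subgroup A G" "A \<noteq> carrier G" for A
  proof (rule less.hyps)
    have "A \<subset> carrier G" using that subgroup.subset by blast
    then show "card (carrier (G\<lparr>carrier := A\<rparr>)) < card (carrier G)"
      using fin by (simp add: psubset_card_mono)
    show "finite (carrier (G\<lparr>carrier := A\<rparr>))" using \<open>A \<subset> carrier G\<close> fin finite_subset by auto
    show "comm_group (G\<lparr>carrier := A\<rparr>)" using less.prems(1) that(1) by (rule comm_group_subgroup)
  qed
  consider (trivial) "carrier G = {\<one>\<^bsub>G\<^esub>}"
    | (primary) p where "prime p" "carrier G \<noteq> {\<one>\<^bsub>G\<^esub>}" "\<And>y. y \<in> carrier G \<Longrightarrow> \<exists>k. y [^]\<^bsub>G\<^esub> ((p::nat) ^ k) = \<one>\<^bsub>G\<^esub>"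
    | (mixed) "carrier G \<noteq> {\<one>\<^bsub>G\<^esub>}" "\<And>p::nat. prime p \<Longrightarrow> \<exists>y\<in>carrier G. \<forall>k. y [^]\<^bsub>G\<^esub> (p ^ k) \<noteq> \<one>\<^bsub>G\<^esub>"
    by blast
  then show ?case
  proof cases
    case trivial
    \<comment> \<open>The product over the empty index set has the everywhere undefined function as
      its only element.\<close>
    have "(\<lambda>_. \<lambda>_\<in>{}. undefined) \<in> iso G (cyclic_product [])"
      unfolding iso_def hom_def bij_betw_def cyclic_product_def using trivial by auto
    then have "has_type G {#}"
      unfolding has_type_def using is_group by (auto simp: is_iso_def)
    then show ?thesis by (intro exI[of _ "{#}"]) simp
  next
    case (primary p)
    have "finite (ord ` carrier G)" "ord ` carrier G \<noteq> {}" using fin by auto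
    then obtain x where x: "x \<in> carrier G" "ord x = Max (ord ` carrier G)"
      using Max_in by (metis imageE)
    have max: "ord y \<le> ord x" if "y \<in> carrier G" for y using x that fin by simp
    have pp: "\<exists>k. ord y = p ^ k" if "y \<in> carrier G" for y
      using primary(3)[OF that] that primary(1) by (auto simp: pow_eq_id divides_primepow_nat)
    then obtain e where e: "ord x = p ^ e" using x by blast
    have exp: "y [^]\<^bsub>G\<^esub> (p ^ e) = \<one>\<^bsub>G\<^esub>" if y: "y \<in> carrier G" for y
    proof -
      obtain k where k: "ord y = p ^ k" using pp y by blast
      then have "p ^ k \<le> p ^ e" using max[OF y] e by simp
      then have "k \<le> e" using prime_gt_1_nat[OF primary(1)] by simp
      then show ?thesis using k y by (simp add: pow_eq_id le_imp_power_dvd)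
    qed
    have "e > 0"
    proof (rule ccontr)
      assume "\<not> e > 0"
      then have "y = \<one>\<^bsub>G\<^esub>" if "y \<in> carrier G" for y using exp[OF that] that by simp
      then show False using primary(2) one_closed by blast
    qed
    obtain K where K: "subgroup K G" "generate G {x} \<inter> K \<subseteq> {\<one>\<^bsub>G\<^esub>}" "generate G {x} <#>\<^bsub>G\<^esub> K = carrier G"
      using cyclic_complement[OF fin primary(1) x(1) e \<open>e > 0\<close> exp] by blast
    have subX: "subgroup (generate G {x}) G" using x by (intro generate_is_subgroup) auto
    have "has_type (G\<lparr>carrier := generate G {x}\<rparr>) {#p ^ e#}"
      using has_type_iso[OF has_type_integer_mod_group subgroup_imp_group[OF subX]]
        group.iso_sym[OF subgroup_imp_group[OF subX] cyclic_subgroup_iso[OF x(1) ord_pos[OF x(1)]]] e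
      by simp
    moreover have "K \<noteq> carrier G"
    proof
      assume "K = carrier G"
      then have "x = \<one>\<^bsub>G\<^esub>" using K(2) x(1) generate.incl[of x "{x}" G] by blast
      then have "p ^ e = 1" using e by simp
      then show False using \<open>e > 0\<close> prime_gt_1_nat[OF primary(1)] by simp
    qed
    then obtain M where M: "\<forall>q\<in>#M. primepow q" "has_type (G\<lparr>carrier := K\<rparr>) M" using IH[OF K(1)] by blast
    ultimately have "has_type G ({#p ^ e#} + M)"
      by (intro has_type_internal_direct_product[OF subX K]) auto
    moreover have "primepow (p ^ e)" using \<open>e > 0\<close> primary(1) by simp
    ultimately show ?thesis using M by (intro exI[of _ "{#p ^ e#} + M"]) auto
  next
    case mixed
    then obtain x where x: "x \<in> carrier G" "x \<noteq> \<one>\<^bsub>G\<^esub>" using one_closed by blast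
    then have "ord x \<noteq> 1" using ord_eq_1 by simp
    then obtain p where p: "prime p" "p dvd ord x" using prime_factor_nat by blast
    obtain y where y: "y \<in> carrier G" "\<And>k. y [^]\<^bsub>G\<^esub> (p ^ k) \<noteq> \<one>\<^bsub>G\<^esub>" using mixed(2)[OF p(1)] by blast
    have "order G > 0" using fin by (simp add: order_gt_0_iff_finite)
    then obtain b where b: "order G = p ^ multiplicity p (order G) * b" "\<not> p dvd b"
      using multiplicity_decompose'[of "order G" p] p(1) by (metis not_prime_unit not_gr0)
    let ?a = "p ^ multiplicity p (order G)"
    let ?A = "{x \<in> carrier G. x [^]\<^bsub>G\<^esub> ?a = \<one>\<^bsub>G\<^esub>}" and ?B = "{x \<in> carrier G. x [^]\<^bsub>G\<^esub> b = \<one>\<^bsub>G\<^esub>}"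
    have cop: "coprime ?a b" using b(2) p(1) by (simp add: prime_imp_coprime)
    have "z [^]\<^bsub>G\<^esub> (?a * b) = \<one>\<^bsub>G\<^esub>" if "z \<in> carrier G" for z
      using pow_order_eq_1[OF that] b(1) by simp
    note dec = coprime_torsion_decomposition[OF cop this]
    have "?A \<noteq> carrier G" using y by blast
    moreover have "?B \<noteq> carrier G"
    proof
      assume "?B = carrier G"
      then have "x [^]\<^bsub>G\<^esub> b = \<one>\<^bsub>G\<^esub>" using x(1) by blast
      then have "ord x dvd b" using x(1) by (simp add: pow_eq_id)
      then show False using p b(2) dvd_trans by blast
    qed
    ultimately obtain M N where "\<forall>q\<in>#M. primepow q" "has_type (G\<lparr>carrier := ?A\<rparr>) M"
      "\<forall>q\<in>#N. primepow q" "has_type (G\<lparr>carrier := ?B\<rparr>) N"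
      using IH[OF subgroup_torsion[of ?a]] IH[OF subgroup_torsion[of b]] by blast
    then show ?thesis
      using has_type_internal_direct_product[OF subgroup_torsion subgroup_torsion dec]
      by (intro exI[of _ "M + N"]) auto
  qed
qed

no_notation Infinite_Set_Sum.abs_summable_on (infix \<open>abs'_summable'_on\<close> 50)

subsection \<open>Dirichlet series over multisets of prime powers\<close>

definition prime_powers_upto :: "nat \<Rightarrow> nat set" where
  "prime_powers_upto r = {p ^ j | p j. prime p \<and> 1 \<le> j \<and> j \<le> r}"

definition msets_over :: "nat set \<Rightarrow> nat multiset set" where
  "msets_over Q = {M. set_mset M \<subseteq> Q}"

definition dirichlet_term :: "complex \<Rightarrow> nat \<Rightarrow> complex" where
  "dirichlet_term s n = of_nat n powr (- s)"

text \<open>For complex bases the branch of the logarithm can spoil this law; the bases here are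
  nonnegative reals.\<close>

lemma dirichlet_term_mult: "dirichlet_term s (m * n) = dirichlet_term s m * dirichlet_term s n"
  unfolding dirichlet_term_def of_nat_mult
  using powr_times_real[of "complex_of_real (real m)" "complex_of_real (real n)"]
  by (simp add: powr_times_real)

lemma dirichlet_term_1 [simp]: "dirichlet_term s (Suc 0) = 1"
  by (simp add: dirichlet_term_def)

lemma dirichlet_term_power: "dirichlet_term s (n ^ k) = dirichlet_term (of_nat k * s) n" if "n > 0"
proof (induction k)
  case 0
  then show ?case using that by (simp add: dirichlet_term_def)
next
  case (Suc k)
  then show ?case using that
    by (simp add: dirichlet_term_mult) (simp add: dirichlet_term_def powr_add[symmetric] algebra_simps)
qed

lemma norm_dirichlet_term: "n > 0 \<Longrightarrow> norm (dirichlet_term s n) = real n powr (- Re s)"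
  unfolding dirichlet_term_def by (simp add: norm_powr_real_powr)

lemma dirichlet_summable:
  assumes "Re s > 1"
  shows "summable (\<lambda>n. norm (dirichlet_term s (Suc n)))"
proof -
  have "summable (\<lambda>n. real n powr (- Re s))" using assms by (simp add: summable_real_powr_iff)
  then have "summable (\<lambda>n. real (Suc n) powr (- Re s))" by (subst summable_Suc_iff)
  then show ?thesis by (simp add: norm_dirichlet_term)
qed

lemma bij_betw_Suc_pos: "bij_betw Suc UNIV {0<..}"
  by (auto simp: bij_betw_def image_iff) (metis Suc_pred)

text \<open>Passes from the ordered series to unordered sums, which can be reindexed along
  bijections with sets of multisets.\<close>

lemma dirichlet_has_sum:
  assumes "Re s > 1"
  shows "dirichlet_term s abs_summable_on {0<..}"
    and "(dirichlet_term s has_sum riemann_zeta s) {0<..}"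
proof -
  have "(\<lambda>n. dirichlet_term s (Suc n)) sums riemann_zeta s"
    unfolding riemann_zeta_def dirichlet_term_def[symmetric]
    using summable_norm_cancel[OF dirichlet_summable[OF assms]] by (rule summable_sums)
  then have "((\<lambda>n. dirichlet_term s (Suc n)) has_sum riemann_zeta s) UNIV"
    by (rule norm_summable_imp_has_sum[OF dirichlet_summable[OF assms]])
  then show "(dirichlet_term s has_sum riemann_zeta s) {0<..}"
    by (simp add: has_sum_reindex_bij_betw[OF bij_betw_Suc_pos])
  have "(\<lambda>n. norm (dirichlet_term s (Suc n))) summable_on UNIV"
    using dirichlet_summable[OF assms] by (intro norm_summable_imp_summable_on) simp
  then show "dirichlet_term s abs_summable_on {0<..}"
    by (simp add: summable_on_reindex_bij_betw[OF bij_betw_Suc_pos, of "\<lambda>n. norm (dirichlet_term s n)"])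
qed

text \<open>The terms after the first have total norm at most \<open>pi\<^sup>2 / 6 - 1\<close>,
  which is less than 1, so they cannot cancel the first term 1.\<close>

lemma riemann_zeta_nonzero:
  assumes "Re s \<ge> 2"
  shows "riemann_zeta s \<noteq> 0"
proof
  assume 0: "riemann_zeta s = 0"
  have 1: "Re s > 1" using assms by simp
  have sm: "summable (\<lambda>n. dirichlet_term s (Suc n))"
    by (rule summable_norm_cancel[OF dirichlet_summable[OF 1]])
  have "riemann_zeta s = (\<Sum>n. dirichlet_term s (Suc n))"
    by (simp add: riemann_zeta_def dirichlet_term_def)
  also have "\<dots> = 1 + (\<Sum>n. dirichlet_term s (Suc (Suc n)))"
    using suminf_split_head[OF sm] by simp
  finally have "(\<Sum>n. dirichlet_term s (Suc (Suc n))) = - 1"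
    using 0 by (metis add_eq_0_iff add.inverse_inverse)
  then have "1 = norm (\<Sum>n. dirichlet_term s (Suc (Suc n)))" by simp
  also have sq: "(\<lambda>n. 1 / (real (Suc n))\<^sup>2) sums (pi\<^sup>2 / 6)"
    using inverse_squares_sums by (simp add: add.commute)
  have sq': "(\<lambda>n. 1 / (real (Suc (Suc n)))\<^sup>2) sums (pi\<^sup>2 / 6 - 1)"
    using sums_Suc_iff[of "\<lambda>n. 1 / (real (Suc n))\<^sup>2" "pi\<^sup>2 / 6 - 1"] sq by simp
  have sn: "summable (\<lambda>n. norm (dirichlet_term s (Suc (Suc n))))"
    using dirichlet_summable[OF 1] by (subst summable_Suc_iff[of "\<lambda>n. norm (dirichlet_term s (Suc n))"])
  have "norm (\<Sum>n. dirichlet_term s (Suc (Suc n))) \<le> (\<Sum>n. norm (dirichlet_term s (Suc (Suc n))))"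
    by (rule summable_norm[OF sn])
  also have "\<dots> \<le> (\<Sum>n. 1 / (real (Suc (Suc n)))\<^sup>2)"
  proof (rule suminf_le[OF _ sn sums_summable[OF sq']])
    fix n
    have "norm (dirichlet_term s (Suc (Suc n))) = real (Suc (Suc n)) powr (- Re s)"
      by (rule norm_dirichlet_term) simp
    also have "\<dots> \<le> real (Suc (Suc n)) powr (- 2)"
      using assms by (intro powr_mono) auto
    also have "\<dots> = 1 / (real (Suc (Suc n)))\<^sup>2"
      by (simp add: powr_minus_divide powr_numeral)
    finally show "norm (dirichlet_term s (Suc (Suc n))) \<le> 1 / (real (Suc (Suc n)))\<^sup>2" .
  qed
  also have "\<dots> = pi\<^sup>2 / 6 - 1" using sq' by (simp add: sums_iff)
  also have "\<dots> < 1"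
  proof -
    \<comment> \<open>The bound 3.2 is only a convenient choice: the square of \<pi> has to stay
      below 12.\<close>
    have "pi\<^sup>2 < 3.2\<^sup>2" using pi_less_4 pi_approx by (intro power_strict_mono) auto
    then show ?thesis by (simp add: power2_eq_square)
  qed
  finally show False by simp
qed

lemma has_sum_product:
  fixes f :: "'a \<Rightarrow> complex" and g :: "'b \<Rightarrow> complex"
  assumes "f abs_summable_on A" "g abs_summable_on B" "(f has_sum a) A" "(g has_sum b) B"
  shows "(\<lambda>(x, y). f x * g y) abs_summable_on A \<times> B"
    and "((\<lambda>(x, y). f x * g y) has_sum (a * b)) (A \<times> B)"
proof -
  show abs: "(\<lambda>(x, y). f x * g y) abs_summable_on A \<times> B"
  proof -
    have "(\<lambda>(x, y). norm (f x) * norm (g y)) summable_on A \<times> B"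
    proof (rule summable_on_SigmaI)
      show "((\<lambda>y. case (x, y) of (x, y) \<Rightarrow> norm (f x) * norm (g y)) has_sum
           (norm (f x) * infsum (\<lambda>y. norm (g y)) B)) B" for x
        using assms(2) by (auto intro!: has_sum_cmult_right)
      show "(\<lambda>x. norm (f x) * infsum (\<lambda>y. norm (g y)) B) summable_on A"
        using assms(1) by (rule summable_on_cmult_left)
    qed auto
    then show ?thesis by (simp add: case_prod_unfold norm_mult)
  qed
  show "((\<lambda>(x, y). f x * g y) has_sum (a * b)) (A \<times> B)"
  proof (rule has_sum_SigmaI)
    show "((\<lambda>y. case (x, y) of (x, y) \<Rightarrow> f x * g y) has_sum (f x * b)) B" for x
      using assms(4) by (auto intro: has_sum_cmult_right)
    show "((\<lambda>x. f x * b) has_sum (a * b)) A" using assms(3) by (rule has_sum_cmult_left)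
    show "(\<lambda>(x, y). f x * g y) summable_on A \<times> B"
      using abs by (rule abs_summable_summable)
  qed
qed

lemma abs_summable_reindex_bij_betw:
  assumes "bij_betw h A B"
  shows "(\<lambda>x. f (h x)) abs_summable_on A \<longleftrightarrow> f abs_summable_on B"
  using summable_on_reindex_bij_betw[OF assms, of "\<lambda>x. norm (f x)"] by simp

lemma prime_power_eq_nat_iff:
  fixes p q :: nat
  assumes "prime p" "prime q" "i > 0"
  shows "p ^ i = q ^ j \<longleftrightarrow> p = q \<and> i = j"
proof
  assume eq: "p ^ i = q ^ j"
  then have "p dvd q ^ j" using assms by (metis dvd_power)
  then have "p = q" using assms by (metis prime_dvd_power primes_dvd_imp_eq)
  then show "p = q \<and> i = j" using eq assms by (metis prime_gt_1_nat power_inject_exp)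
qed auto

text \<open>A multiset of \<open>(r + 1)\<close>-th powers of primes is the prime factorisation of a positive integer
  with every prime replaced by its power.\<close>
lemma bij_betw_prime_power_msets:
  "bij_betw (\<lambda>(M, n). M + image_mset (\<lambda>p. p ^ Suc r) (prime_factorization n))
     (msets_over (prime_powers_upto r) \<times> {0<..}) (msets_over (prime_powers_upto (Suc r)))"
proof -
  define P where "P = (\<lambda>q::nat. \<exists>p. prime p \<and> q = p ^ Suc r)"
  define R where "R = (\<lambda>q::nat. THE p. prime p \<and> q = p ^ Suc r)"
  have R: "R (p ^ Suc r) = p" if "prime p" for p
    unfolding R_def using that by (intro the_equality) (auto simp: prime_power_eq_nat_iff simp del: power_Suc)
  have notP: "\<not> P q" if "q \<in> prime_powers_upto r" for q
    using that by (auto simp: P_def prime_powers_upto_def prime_power_eq_nat_iff simp del: power_Suc)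
  have split: "q \<in> prime_powers_upto (Suc r) \<longleftrightarrow> q \<in> prime_powers_upto r \<or> P q" for q
    unfolding prime_powers_upto_def P_def by (auto simp: le_Suc_eq simp del: power_Suc)
  have P_pf: "P (p ^ Suc r)" if "p \<in># prime_factorization n" for p n :: nat
    using that by (auto simp: P_def simp del: power_Suc)
  define h where "h = (\<lambda>(M, n). M + image_mset (\<lambda>p. p ^ Suc r) (prime_factorization (n::nat)))"
  \<comment> \<open>The inverse of \<open>h\<close>: entries that are not \<open>Suc r\<close>-th
    powers of primes stay, and the primes underlying the other entries are multiplied to an
    integer.\<close>
  define k where "k = (\<lambda>M. (filter_mset (\<lambda>q. \<not> P q) M, \<Prod>\<^sub># (image_mset R (filter_mset P M))))"
  have prR: "prime (R q)" "R q ^ Suc r = q" if "P q" for q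
    using that R by (auto simp: P_def simp del: power_Suc)
  have "bij_betw h (msets_over (prime_powers_upto r) \<times> {0<..}) (msets_over (prime_powers_upto (Suc r)))"
  proof (rule bij_betw_byWitness[where f' = k])
    show "\<forall>x\<in>msets_over (prime_powers_upto r) \<times> {0<..}. k (h x) = x"
    proof
      fix x assume "x \<in> msets_over (prime_powers_upto r) \<times> {0::nat<..}"
      then obtain M n where x: "x = (M, n)" and M: "M \<in> msets_over (prime_powers_upto r)" and n: "n > 0"
        by auto
      have 1: "filter_mset (\<lambda>q. \<not> P q) M = M"
        using M notP by (intro filter_mset_eq_conv[THEN iffD2]) (auto simp: msets_over_def)
      have 2: "filter_mset P M = {#}"
        using M notP by (intro multiset_eqI) (auto simp: msets_over_def count_eq_zero_iff)
      let ?F = "image_mset (\<lambda>p. p ^ Suc r) (prime_factorization n)"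
      have 3: "filter_mset (\<lambda>q. \<not> P q) ?F = {#}"
        using P_pf by (intro multiset_eqI) (auto simp: count_eq_zero_iff simp del: power_Suc)
      have 4: "filter_mset P ?F = ?F"
        using P_pf by (intro filter_mset_eq_conv[THEN iffD2]) (auto simp del: power_Suc)
      have "image_mset R ?F = image_mset (\<lambda>p. p) (prime_factorization n)"
        unfolding multiset.map_comp by (intro image_mset_cong) (simp add: R in_prime_factors_imp_prime del: power_Suc)
      then have "\<Prod>\<^sub># (image_mset R ?F) = n"
        using n by (simp add: prod_mset_prime_factorization_nat)
      then show "k (h x) = x"
        by (simp add: x h_def k_def 1 2 3 4 del: power_Suc)
    qed
    show "\<forall>M\<in>msets_over (prime_powers_upto (Suc r)). h (k M) = M"
    proof
      fix M assume "M \<in> msets_over (prime_powers_upto (Suc r))"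
      have "prime_factorization (\<Prod>\<^sub># (image_mset R (filter_mset P M))) = image_mset R (filter_mset P M)"
        by (rule prime_factorization_prod_mset_primes) (auto simp: prR)
      moreover have "image_mset (\<lambda>p. p ^ Suc r) (image_mset R (filter_mset P M)) = filter_mset P M"
      proof -
        have "image_mset (\<lambda>q. R q ^ Suc r) (filter_mset P M) = image_mset (\<lambda>q. q) (filter_mset P M)"
          by (intro image_mset_cong) (simp add: prR del: power_Suc)
        then show ?thesis by (simp add: multiset.map_comp o_def del: power_Suc)
      qed
      ultimately show "h (k M) = M"
        by (simp add: h_def k_def multiset_partition[symmetric] add.commute del: power_Suc)
    qed
    show "h ` (msets_over (prime_powers_upto r) \<times> {0<..}) \<subseteq> msets_over (prime_powers_upto (Suc r))"
      using P_pf by (auto simp: h_def msets_over_def split simp del: power_Suc)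
    show "k ` msets_over (prime_powers_upto (Suc r)) \<subseteq> msets_over (prime_powers_upto r) \<times> {0<..}"
      using split by (auto simp: k_def msets_over_def intro!: gr0I dest!: prR(1))
  qed
  then show ?thesis unfolding h_def .
qed

text \<open>Induction on the largest exponent. Allowing the exponent \<open>Suc r\<close> adds an
  independent positive integer \<open>n\<close> that enters the product as \<open>n ^ Suc r\<close>;
  the sum over \<open>n\<close> is the new zeta factor.\<close>

lemma prime_power_msets_has_sum:
  assumes "Re s > 1"
  shows "(\<lambda>M. dirichlet_term s (\<Prod>\<^sub># M)) abs_summable_on msets_over (prime_powers_upto r) \<and>
    ((\<lambda>M. dirichlet_term s (\<Prod>\<^sub># M)) has_sum (\<Prod>k=1..r. riemann_zeta (of_nat k * s)))
       (msets_over (prime_powers_upto r))"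
proof (induction r)
  case 0
  have "msets_over (prime_powers_upto 0) = {{#}}"
    by (auto simp: msets_over_def prime_powers_upto_def)
  then show ?case using has_sum_finite[of "{{#}}" "\<lambda>M. dirichlet_term s (\<Prod>\<^sub># M)"] by simp
next
  case (Suc r)
  have "1 * 1 < real (Suc r) * Re s" using assms by (intro mult_le_less_imp_less) auto
  then have Re: "Re (of_nat (Suc r) * s) > 1" by simp
  note P = has_sum_product[OF conjunct1[OF Suc] dirichlet_has_sum(1)[OF Re]
      conjunct2[OF Suc] dirichlet_has_sum(2)[OF Re]]
  let ?h = "\<lambda>(M, n). M + image_mset (\<lambda>p. p ^ Suc r) (prime_factorization n)"
  have eq: "dirichlet_term s (\<Prod>\<^sub># (?h x)) =
      (case x of (M, n) \<Rightarrow> dirichlet_term s (\<Prod>\<^sub># M) * dirichlet_term (of_nat (Suc r) * s) n)"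
    if "x \<in> msets_over (prime_powers_upto r) \<times> {0<..}" for x
  proof -
    obtain M n where x: "x = (M, n)" "n > 0" using \<open>x \<in> _\<close> by (cases x) auto
    have "\<Prod>\<^sub># (image_mset (\<lambda>p. p ^ Suc r) M) = (\<Prod>\<^sub># M) ^ Suc r" for M :: "nat multiset"
      by (induction M) (simp_all add: power_mult_distrib del: power_Suc)
    then have "\<Prod>\<^sub># (image_mset (\<lambda>p. p ^ Suc r) (prime_factorization n)) = n ^ Suc r"
      using x by (simp add: prod_mset_prime_factorization_nat del: power_Suc)
    then show ?thesis using x by (simp add: dirichlet_term_mult dirichlet_term_power del: power_Suc)
  qed
  have 1: "(\<lambda>x. dirichlet_term s (\<Prod>\<^sub># (?h x))) abs_summable_on msets_over (prime_powers_upto r) \<times> {0<..}"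
    using P(1) by (subst summable_on_cong[OF arg_cong[OF eq]])
  have 2: "((\<lambda>x. dirichlet_term s (\<Prod>\<^sub># (?h x))) has_sum
      (\<Prod>k=1..Suc r. riemann_zeta (of_nat k * s))) (msets_over (prime_powers_upto r) \<times> {0<..})"
    using P(2) by (subst has_sum_cong[OF eq]) simp_all
  show ?case
    using 1 2 unfolding abs_summable_reindex_bij_betw[OF bij_betw_prime_power_msets, where f = "\<lambda>M. dirichlet_term s (\<Prod>\<^sub># M)"]
      has_sum_reindex_bij_betw[OF bij_betw_prime_power_msets, where f = "\<lambda>M. dirichlet_term s (\<Prod>\<^sub># M)"]
    by simp
qed

section \<open>The Dirichlet series of pairs of disjoint multisets\<close>

definition disjoint_pairs :: "nat set \<Rightarrow> (nat multiset \<times> nat multiset) set" where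
  "disjoint_pairs Q = {(A, B). A \<in> msets_over Q \<and> B \<in> msets_over Q \<and> A \<inter># B = {#}}"

text \<open>The analogue of dividing two integers by their gcd: adding the same \<open>C\<close> to
  disjoint multisets makes \<open>C\<close> exactly their intersection, which can therefore be read
  off and removed.\<close>

lemma bij_betw_gcd_split:
  "bij_betw (\<lambda>(C, A, B). (C + A, C + B)) (msets_over Q \<times> disjoint_pairs Q) (msets_over Q \<times> msets_over Q)"
proof (rule bij_betw_byWitness[where f' = "\<lambda>(A, B). (A \<inter># B, A - A \<inter># B, B - A \<inter># B)"])
  have *: "(C + A) \<inter># (C + B) = C" if "A \<inter># B = {#}" for A B C :: "nat multiset"
  proof (rule multiset_eqI)
    fix x
    have "count (A \<inter># B) x = 0" using that by simp
    then show "count ((C + A) \<inter># (C + B)) x = count C x" by (simp add: min_def split: if_splits)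
  qed
  have **: "A - B = A" if "A \<inter># B = {#}" for A B :: "nat multiset"
    using that by (metis diff_empty diff_intersect_left_idem)
  have ***: "B - A = B" if "A \<inter># B = {#}" for A B :: "nat multiset"
    using that by (intro **) (simp add: multiset_eq_iff min.commute)
  show "\<forall>x\<in>msets_over Q \<times> disjoint_pairs Q. (\<lambda>(A, B). (A \<inter># B, A - A \<inter># B, B - A \<inter># B))
      ((\<lambda>(C, A, B). (C + A, C + B)) x) = x"
    by (auto simp: disjoint_pairs_def * ** ***)
  have 4: "A \<inter># B + (A - B) = A" "A \<inter># B + (B - A) = B" for A B :: "nat multiset"
    by (auto simp: multiset_eq_iff)
  show "\<forall>x\<in>msets_over Q \<times> msets_over Q. (\<lambda>(C, A, B). (C + A, C + B))
      ((\<lambda>(A, B). (A \<inter># B, A - A \<inter># B, B - A \<inter># B)) x) = x"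
    by (auto simp: 4)
  show "(\<lambda>(C, A, B). (C + A, C + B)) ` (msets_over Q \<times> disjoint_pairs Q) \<subseteq> msets_over Q \<times> msets_over Q"
    by (auto simp: disjoint_pairs_def msets_over_def)
  show "(\<lambda>(A, B). (A \<inter># B, A - A \<inter># B, B - A \<inter># B)) ` (msets_over Q \<times> msets_over Q)
      \<subseteq> msets_over Q \<times> disjoint_pairs Q"
    by (auto simp: disjoint_pairs_def msets_over_def multiset_eq_iff dest: in_diffD)
qed

text \<open>The common part \<open>C\<close> enters both components, so it contributes the square of
  its term, which is its term at \<open>2 * s\<close>. Evaluating the sum over all pairs with and
  without splitting off \<open>C\<close> gives an equation that can be solved for the sum over
  disjoint pairs.\<close>

lemma disjoint_pairs_has_sum:
  assumes "Re s > 1"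
  shows "((\<lambda>(A, B). dirichlet_term s (\<Prod>\<^sub># A * \<Prod>\<^sub># B)) has_sum
     ((\<Prod>k=1..r. (riemann_zeta (of_nat k * s))\<^sup>2) / (\<Prod>k=1..r. riemann_zeta (of_nat (2 * k) * s))))
     (disjoint_pairs (prime_powers_upto r))"
proof -
  define Q where "Q = prime_powers_upto r"
  define f where "f = (\<lambda>s M. dirichlet_term s (\<Prod>\<^sub># M))"
  define Z where "Z = (\<Prod>k=1..r. riemann_zeta (of_nat k * s))"
  define Z2 where "Z2 = (\<Prod>k=1..r. riemann_zeta (of_nat (2 * k) * s))"
  define g where "g = (\<lambda>(A, B). f s A * f s B)"
  have Z2: "Z2 = (\<Prod>k=1..r. riemann_zeta (of_nat k * (2 * s)))"
    unfolding Z2_def by (intro prod.cong refl arg_cong[where f = riemann_zeta]) (simp add: algebra_simps)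
  have Q0: "0 \<notin> Q" by (auto simp: Q_def prime_powers_upto_def)
  have S1: "f s abs_summable_on msets_over Q" "(f s has_sum Z) (msets_over Q)"
    using prime_power_msets_has_sum[OF assms, of r] by (simp_all add: f_def Z_def Q_def)
  have "Re (2 * s) > 1" using assms by simp
  then have S2: "f (2 * s) abs_summable_on msets_over Q" "(f (2 * s) has_sum Z2) (msets_over Q)"
    using prime_power_msets_has_sum[of "2 * s" r] by (simp_all add: f_def Z2 Q_def)
  have P: "g abs_summable_on msets_over Q \<times> msets_over Q"
      "(g has_sum Z * Z) (msets_over Q \<times> msets_over Q)"
    unfolding g_def
    using has_sum_product[OF S1(1) S1(1) S1(2) S1(2)] by blast+
  let ?h = "\<lambda>(C, A, B). (C + A, C + B :: nat multiset)"
  have eq: "g (?h x) = (case x of (C, y) \<Rightarrow> f (2 * s) C * g y)" if "x \<in> msets_over Q \<times> disjoint_pairs Q" for x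
  proof -
    obtain C A B where x: "x = (C, A, B)" by (cases x) auto
    with that have C: "C \<in> msets_over Q" by simp
    have "\<Prod>\<^sub># C > 0" using C Q0 by (auto simp: msets_over_def intro!: gr0I)
    then have "f s C * f s C = f (2 * s) C"
      using dirichlet_term_power[of "\<Prod>\<^sub># C" s 2] by (simp add: f_def power2_eq_square dirichlet_term_mult)
    then show ?thesis
      using x by (simp add: g_def f_def dirichlet_term_mult algebra_simps)
  qed
  have 1: "(\<lambda>x. g (?h x)) abs_summable_on msets_over Q \<times> disjoint_pairs Q"
    using P(1) unfolding abs_summable_reindex_bij_betw[OF bij_betw_gcd_split] .
  have 2: "((\<lambda>x. g (?h x)) has_sum Z * Z) (msets_over Q \<times> disjoint_pairs Q)"
    using P(2) unfolding has_sum_reindex_bij_betw[OF bij_betw_gcd_split] .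
  have 3: "((\<lambda>(C, y). f (2 * s) C * g y) has_sum Z * Z) (msets_over Q \<times> disjoint_pairs Q)"
    by (rule has_sum_cong[OF eq, THEN iffD1, OF _ 2])
  \<comment> \<open>Absolute convergence passes to the subset of disjoint pairs; it has to be known
    before their sum can be separated as a factor.\<close>
  have "g abs_summable_on disjoint_pairs Q"
    using P(1) by (rule summable_on_subset) (auto simp: disjoint_pairs_def)
  then have 4: "(g has_sum infsum g (disjoint_pairs Q)) (disjoint_pairs Q)"
    by (rule has_sum_infsum[OF abs_summable_summable])
  have "((\<lambda>(C, y). f (2 * s) C * g y) has_sum Z2 * infsum g (disjoint_pairs Q)) (msets_over Q \<times> disjoint_pairs Q)"
    by (rule has_sum_product(2)[OF S2(1) \<open>g abs_summable_on disjoint_pairs Q\<close> S2(2) 4])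
  with 3 have "Z * Z = Z2 * infsum g (disjoint_pairs Q)"
    by (rule has_sum_unique)
  moreover have "Z2 \<noteq> 0"
    unfolding Z2_def
  proof (subst prod_zero_iff, simp, safe)
    fix k assume k: "k \<in> {1..r}" "riemann_zeta (of_nat (2 * k) * s) = 0"
    have "2 * 1 \<le> real (2 * k) * Re s" using assms k by (intro mult_mono) auto
    then have "Re (of_nat (2 * k) * s) \<ge> 2" by simp
    then show False using riemann_zeta_nonzero k by blast
  qed
  ultimately have "infsum g (disjoint_pairs Q) = Z\<^sup>2 / Z2" by (simp add: field_simps power2_eq_square)
  with 4 have "(g has_sum Z\<^sup>2 / Z2) (disjoint_pairs Q)" by simp
  then show ?thesis
    by (simp add: Z_def Z2_def Q_def g_def f_def dirichlet_term_mult prod_power_distrib)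
qed

text \<open>All entries are at least 2, so the product bounds every entry and also the number of
  entries.\<close>

lemma finite_msets_over_prod_le: "finite {A \<in> msets_over (prime_powers_upto r). \<Prod>\<^sub># A \<le> N}"
proof (rule finite_subset)
  show "{A \<in> msets_over (prime_powers_upto r). \<Prod>\<^sub># A \<le> N} \<subseteq> (\<Union>k\<le>N. multisets_of_size {..N} k)"
  proof safe
    fix A assume A: "A \<in> msets_over (prime_powers_upto r)" "\<Prod>\<^sub># A \<le> N"
    have ge2: "q \<ge> 2" if q: "q \<in># A" for q
    proof -
      obtain p j where "q = p ^ j" "prime p" "j \<ge> 1"
        using subsetD[OF _ q, of "prime_powers_upto r"] A(1)
        by (auto simp: msets_over_def prime_powers_upto_def)
      then have "p ^ 1 \<le> q" using prime_gt_0_nat[of p] power_increasing[of 1 j p] by simp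
      with prime_ge_2_nat[OF \<open>prime p\<close>] show ?thesis by simp
    qed
    have size: "size B < \<Prod>\<^sub># B" if "\<And>q. q \<in># B \<Longrightarrow> q \<ge> 2" for B :: "nat multiset"
      using that
    proof (induction B)
      case (add q B)
      then have "size B < \<Prod>\<^sub># B" "2 \<le> q" by auto
      then have "2 * Suc (size B) \<le> q * \<Prod>\<^sub># B" by (intro mult_mono) auto
      then show ?case by simp
    qed auto
    have "q \<le> N" if "q \<in># A" for q
    proof -
      have "q dvd \<Prod>\<^sub># A" using that by (rule dvd_prod_mset)
      moreover have "\<Prod>\<^sub># A > 0" using size[of A] ge2 by fastforce
      ultimately have "q \<le> \<Prod>\<^sub># A" by (rule dvd_imp_le)
      then show ?thesis using A(2) by simp
    qed
    moreover have "size A \<le> N" using size[of A] ge2 A(2) by fastforce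
    ultimately show "A \<in> (\<Union>k\<le>N. multisets_of_size {..N} k)" by (auto simp: multisets_of_size_def)
  qed
qed (auto intro: finite_multisets_of_size)

text \<open>Collecting the pairs by total product turns the unordered sum back into an ordered
  Dirichlet series; the fibres are finite, so each contributes its cardinality times a single
  term.\<close>

lemma disjoint_pairs_sums:
  assumes "Re s > 1"
  shows "(\<lambda>n. of_nat (card {(A, B) \<in> disjoint_pairs (prime_powers_upto r). \<Prod>\<^sub># A * \<Prod>\<^sub># B = Suc n}) *
       of_nat (Suc n) powr (- s)) sums
     ((\<Prod>k=1..r. (riemann_zeta (of_nat k * s))\<^sup>2) / (\<Prod>k=1..r. riemann_zeta (of_nat (2 * k) * s)))"
    (is "_ sums ?Z")
proof -
  let ?D = "disjoint_pairs (prime_powers_upto r)"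
  define F where "F = (\<lambda>n. {(A, B) \<in> ?D. \<Prod>\<^sub># A * \<Prod>\<^sub># B = Suc n})"
  have pos: "\<Prod>\<^sub># A > 0" if "A \<in> msets_over (prime_powers_upto r)" for A
    using that by (auto simp: msets_over_def prime_powers_upto_def intro!: gr0I)
  have finQ: "finite (F n)" for n
  proof (rule finite_subset)
    show "F n \<subseteq> {A \<in> msets_over (prime_powers_upto r). \<Prod>\<^sub># A \<le> Suc n} \<times>
        {A \<in> msets_over (prime_powers_upto r). \<Prod>\<^sub># A \<le> Suc n}"
      using pos by (auto simp: F_def disjoint_pairs_def simp del: mult_Suc_right) (metis dvd_imp_le dvd_triv_left dvd_triv_right zero_less_Suc)+
  qed (simp add: finite_msets_over_prod_le)
  \<comment> \<open>The fibre over \<open>n\<close> holds the pairs with product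
    \<open>Suc n\<close>. Products are positive, so truncated subtraction of 1 recovers
    \<open>n\<close>.\<close>
  have bij: "bij_betw snd (Sigma UNIV F) ?D"
  proof (rule bij_betw_byWitness[where f' = "\<lambda>(A, B). (\<Prod>\<^sub># A * \<Prod>\<^sub># B - 1, A, B)"])
    show "(\<lambda>(A, B). (\<Prod>\<^sub># A * \<Prod>\<^sub># B - 1, A, B)) ` ?D \<subseteq> Sigma UNIV F"
      using pos by (auto simp: F_def disjoint_pairs_def)
  qed (auto simp: F_def)
  have "((\<lambda>x. (\<lambda>(A, B). dirichlet_term s (\<Prod>\<^sub># A * \<Prod>\<^sub># B)) (snd x)) has_sum ?Z) (Sigma UNIV F)"
    unfolding has_sum_reindex_bij_betw[OF bij] by (rule disjoint_pairs_has_sum[OF assms])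
  then have "((\<lambda>n. of_nat (card (F n)) * dirichlet_term s (Suc n)) has_sum ?Z) UNIV"
  proof (rule has_sum_SigmaD)
    fix n
    have "(\<Sum>x\<in>F n. (\<lambda>(A, B). dirichlet_term s (\<Prod>\<^sub># A * \<Prod>\<^sub># B)) x) = of_nat (card (F n)) * dirichlet_term s (Suc n)"
      by (subst sum.cong[OF refl, of _ _ "\<lambda>_. dirichlet_term s (Suc n)"]) (auto simp: F_def)
    then show "((\<lambda>y. (\<lambda>(A, B). dirichlet_term s (\<Prod>\<^sub># A * \<Prod>\<^sub># B)) (snd (n, y))) has_sum
        of_nat (card (F n)) * dirichlet_term s (Suc n)) (F n)"
      using has_sum_finite[OF finQ, of "\<lambda>(A, B). dirichlet_term s (\<Prod>\<^sub># A * \<Prod>\<^sub># B)" n] by simp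
  qed
  then have "(\<lambda>n. of_nat (card (F n)) * dirichlet_term s (Suc n)) sums ?Z"
    by (rule has_sum_imp_sums)
  then show ?thesis unfolding F_def dirichlet_term_def .
qed

subsection \<open>Isomorphism classes as multisets of prime powers\<close>

text \<open>Prime powers single out one type, so for finite abelian groups the description is
  definite and yields a complete invariant.\<close>

definition ab_type :: "('a, 'b) monoid_scheme \<Rightarrow> nat multiset" where
  "ab_type G = (THE M. (\<forall>q\<in>#M. primepow q) \<and> has_type G M)"

lemma ab_type_eqI:
  assumes "\<And>q. q \<in># M \<Longrightarrow> primepow q" "has_type G M"
  shows "ab_type G = M"
  unfolding ab_type_def using assms by (intro the_equality) (auto intro: has_type_unique)

lemma ab_type_props:
  assumes "fin_ab_group G"
  shows primepow_ab_type: "\<And>q. q \<in># ab_type G \<Longrightarrow> primepow q" and has_type_ab_type: "has_type G (ab_type G)"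
proof -
  obtain M where M: "\<And>q. q \<in># M \<Longrightarrow> primepow q" "has_type G M"
    using has_type_exists assms unfolding fin_ab_group_def by blast
  then have "ab_type G = M" by (rule ab_type_eqI)
  with M show "\<And>q. q \<in># ab_type G \<Longrightarrow> primepow q" "has_type G (ab_type G)" by auto
qed

lemma fin_ab_group_has_type:
  assumes "\<And>q. q \<in># M \<Longrightarrow> primepow q" "has_type G M"
  shows "fin_ab_group G"
proof -
  have "0 \<notin># M" using assms(1) by (metis zero_not_primepow)
  then show ?thesis
    using has_type_comm_group[OF assms(2)] order_has_type(1)[OF assms(2)] by (simp add: fin_ab_group_def)
qed

lemma iso_iff_ab_type_eq:
  assumes "fin_ab_group G" "fin_ab_group H"
  shows "G \<cong> H \<longleftrightarrow> ab_type G = ab_type H"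
proof
  assume "G \<cong> H"
  then have "has_type H (ab_type G)"
    using has_type_iso has_type_ab_type[OF assms(1)] has_type_group[OF has_type_ab_type[OF assms(2)]] by blast
  then show "ab_type G = ab_type H" using primepow_ab_type[OF assms(1)] by (metis ab_type_eqI)
next
  assume "ab_type G = ab_type H"
  then show "G \<cong> H" using has_type_imp_iso has_type_ab_type assms by metis
qed

lemma DirProd_ab_type:
  assumes "fin_ab_group G" "fin_ab_group H"
  shows fin_ab_group_DirProd: "fin_ab_group (G \<times>\<times> H)"
    and ab_type_DirProd: "ab_type (G \<times>\<times> H) = ab_type G + ab_type H"
proof -
  have 1: "has_type (G \<times>\<times> H) (ab_type G + ab_type H)"
    by (intro has_type_DirProd has_type_ab_type assms)
  have 2: "primepow q" if "q \<in># ab_type G + ab_type H" for q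
    using that primepow_ab_type[OF assms(1)] primepow_ab_type[OF assms(2)] by auto
  show "fin_ab_group (G \<times>\<times> H)" by (rule fin_ab_group_has_type[OF 2 1])
  show "ab_type (G \<times>\<times> H) = ab_type G + ab_type H" by (rule ab_type_eqI[OF 2 1])
qed

lemma torsion_card_ab_type:
  assumes "fin_ab_group G"
  shows "torsion_card G d = (\<Prod>q\<in>#ab_type G. gcd d q)"
  using torsion_card_has_type[OF has_type_ab_type[OF assms]] primepow_ab_type[OF assms]
  by (metis zero_not_primepow)

lemma order_ab_type:
  assumes "fin_ab_group G"
  shows "order G = \<Prod>\<^sub># (ab_type G)"
  using order_has_type(2)[OF has_type_ab_type[OF assms]] primepow_ab_type[OF assms]
  by (metis zero_not_primepow)

text \<open>Cyclic products live on functions, whereas isomorphism classes are formed among groups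
  on natural numbers. The structure is transported along a numbering of the carrier.\<close>

lemma exists_iso_nat_group:
  assumes "group G" "finite (carrier G)"
  shows "\<exists>H :: nat monoid. group H \<and> G \<cong> H"
proof -
  interpret group G by fact
  obtain f where f: "bij_betw f (carrier G) {0..<card (carrier G)}"
    using ex_bij_betw_finite_nat[OF assms(2)] by blast
  define g where "g = inv_into (carrier G) f"
  have gf: "g (f x) = x" if "x \<in> carrier G" for x
    using bij_betw_inv_into_left[OF f that] by (simp add: g_def)
  define H :: "nat monoid" where
    "H = \<lparr>carrier = f ` carrier G, mult = (\<lambda>x y. f (g x \<otimes>\<^bsub>G\<^esub> g y)), one = f \<one>\<^bsub>G\<^esub>\<rparr>"
  have "group H"
  proof (rule groupI)
    fix x assume "x \<in> carrier H"
    then obtain u where u: "u \<in> carrier G" "x = f u" by (auto simp: H_def)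
    then show "\<exists>y\<in>carrier H. y \<otimes>\<^bsub>H\<^esub> x = \<one>\<^bsub>H\<^esub>"
      by (intro bexI[of _ "f (inv\<^bsub>G\<^esub> u)"]) (auto simp: H_def gf)
  qed (auto simp: H_def gf m_assoc)
  moreover have "f \<in> iso G H"
    using f by (auto simp: iso_def hom_def H_def gf bij_betw_def)
  ultimately show ?thesis by (auto simp: is_iso_def)
qed

lemma exists_nat_group_of_ab_type:
  assumes "\<And>q. q \<in># M \<Longrightarrow> primepow q"
  shows "\<exists>G :: nat monoid. fin_ab_group G \<and> ab_type G = M"
proof -
  obtain l where l: "mset l = M" using ex_mset by blast
  have 1: "has_type (cyclic_product l) M" using has_type_cyclic_product[of l] l by simp
  have "fin_ab_group (cyclic_product l)" by (rule fin_ab_group_has_type[OF assms 1])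
  then obtain H :: "nat monoid" where "group H" "cyclic_product l \<cong> H"
    using exists_iso_nat_group[OF group_cyclic_product] by (auto simp: fin_ab_group_def)
  then have H: "has_type H M" by (rule has_type_iso[OF 1])
  show ?thesis using fin_ab_group_has_type[OF assms H] ab_type_eqI[OF assms H] by blast
qed

text \<open>Allows sums and cardinalities over isomorphism classes to be computed over multisets.
  Distinct types give distinct classes because every class involved contains a member of
  \<open>X\<close>.\<close>

lemma quotient_ab_iso:
  assumes "\<And>G. G \<in> X \<Longrightarrow> fin_ab_group G"
  shows "X // ab_iso = (\<lambda>M. {H. fin_ab_group H \<and> ab_type H = M}) ` (ab_type ` X)"
    and "inj_on (\<lambda>M. {H :: nat monoid. fin_ab_group H \<and> ab_type H = M}) (ab_type ` X)"
proof -
  have "ab_iso `` {G} = {H. fin_ab_group H \<and> ab_type H = ab_type G}" if "G \<in> X" for G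
    using assms[OF that] by (auto simp: ab_iso_def iso_iff_ab_type_eq)
  then show "X // ab_iso = (\<lambda>M. {H. fin_ab_group H \<and> ab_type H = M}) ` (ab_type ` X)"
    by (auto simp: quotient_def image_iff)
  show "inj_on (\<lambda>M. {H :: nat monoid. fin_ab_group H \<and> ab_type H = M}) (ab_type ` X)"
    using assms by (intro inj_onI) blast
qed

text \<open>A complement is obtained by realising the multiset difference of the two types as a
  group.\<close>

lemma direct_factor_iff:
  assumes "fin_ab_group H"
  shows "direct_factor D H \<longleftrightarrow> fin_ab_group D \<and> ab_type D \<subseteq># ab_type H"
proof
  assume "direct_factor D H"
  then obtain A :: "nat monoid" where "fin_ab_group D" "fin_ab_group A" "H \<cong> D \<times>\<times> A"
    by (auto simp: direct_factor_def)
  then show "fin_ab_group D \<and> ab_type D \<subseteq># ab_type H"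
    using assms by (simp add: iso_iff_ab_type_eq fin_ab_group_DirProd ab_type_DirProd)
next
  assume D: "fin_ab_group D \<and> ab_type D \<subseteq># ab_type H"
  obtain A :: "nat monoid" where A: "fin_ab_group A" "ab_type A = ab_type H - ab_type D"
    using exists_nat_group_of_ab_type[of "ab_type H - ab_type D"] primepow_ab_type[OF assms]
    by (meson in_diffD)
  then have "H \<cong> D \<times>\<times> A"
    using assms D by (simp add: iso_iff_ab_type_eq fin_ab_group_DirProd ab_type_DirProd)
  then show "direct_factor D H" using D A by (auto simp: direct_factor_def)
qed

text \<open>The intersection of the types is the type of the largest common direct factor, so a
  nontrivial common factor exists exactly if the intersection is nonempty.\<close>

lemma unitary_factors_iff:
  assumes "fin_ab_group G"
  shows "unitary_factors G H K \<longleftrightarrow> fin_ab_group H \<and> fin_ab_group K \<and>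
    ab_type G = ab_type H + ab_type K \<and> ab_type H \<inter># ab_type K = {#}"
proof (cases "fin_ab_group H \<and> fin_ab_group K")
  case True
  then have H: "fin_ab_group H" and K: "fin_ab_group K" by auto
  have order1: "order D = 1 \<longleftrightarrow> ab_type D = {#}" if "fin_ab_group D" for D :: "nat monoid"
  proof
    assume "order D = 1"
    then have 1: "\<Prod>\<^sub># (ab_type D) = 1" using order_ab_type[OF that] by simp
    show "ab_type D = {#}"
    proof (rule ccontr)
      assume "ab_type D \<noteq> {#}"
      then obtain q where q: "q \<in># ab_type D" by auto
      then have "q dvd 1" using dvd_prod_mset[OF q] 1 by simp
      then show False using primepow_ab_type[OF that q] by auto
    qed
  qed (simp add: order_ab_type[OF that])
  have "(\<exists>D. direct_factor D H \<and> direct_factor D K \<and> order D \<noteq> 1) \<longleftrightarrow> ab_type H \<inter># ab_type K \<noteq> {#}"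
  proof
    assume "\<exists>D. direct_factor D H \<and> direct_factor D K \<and> order D \<noteq> 1"
    then obtain D :: "nat monoid" where D: "fin_ab_group D" "ab_type D \<subseteq># ab_type H" "ab_type D \<subseteq># ab_type K" "order D \<noteq> 1"
      by (auto simp: direct_factor_iff[OF H] direct_factor_iff[OF K])
    then have "ab_type D \<subseteq># ab_type H \<inter># ab_type K" by simp
    moreover have "ab_type D \<noteq> {#}" using D order1 by blast
    ultimately show "ab_type H \<inter># ab_type K \<noteq> {#}" by (metis subset_mset.le_zero_eq)
  next
    assume ne: "ab_type H \<inter># ab_type K \<noteq> {#}"
    obtain D :: "nat monoid" where D: "fin_ab_group D" "ab_type D = ab_type H \<inter># ab_type K"
      using exists_nat_group_of_ab_type[of "ab_type H \<inter># ab_type K"] primepow_ab_type[OF H] by auto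
    then show "\<exists>D. direct_factor D H \<and> direct_factor D K \<and> order D \<noteq> 1"
      using ne order1 by (intro exI[of _ D]) (simp add: direct_factor_iff[OF H] direct_factor_iff[OF K])
  qed
  then show ?thesis
    using H K assms
    by (simp add: unitary_factors_def iso_iff_ab_type_eq fin_ab_group_DirProd ab_type_DirProd)
qed (auto simp: unitary_factors_def)

text \<open>The definition counts classes of \<open>H\<close> alone. Cancellation determines the
  type of \<open>K\<close> from that of \<open>H\<close>, so pairs can be counted instead.\<close>

lemma num_unitary_factors_eq:
  assumes "fin_ab_group G"
  shows "num_unitary_factors G = card {(A, B). A + B = ab_type G \<and> A \<inter># B = {#}}"
proof -
  define X where "X = {H. \<exists>K. unitary_factors G H K}"
  define P where "P = {(A, B). A + B = ab_type G \<and> A \<inter># B = {#}}"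
  have fin: "fin_ab_group H" if "H \<in> X" for H
    using that by (auto simp: X_def unitary_factors_iff[OF assms])
  have "ab_type ` X = fst ` P"
  proof (intro equalityI subsetI)
    fix A assume "A \<in> ab_type ` X"
    then obtain H K where "A = ab_type H" "unitary_factors G H K" by (auto simp: X_def)
    then have "(A, ab_type K) \<in> P" by (simp add: P_def unitary_factors_iff[OF assms])
    then show "A \<in> fst ` P" by (rule image_eqI[rotated]) simp
  next
    fix A assume "A \<in> fst ` P"
    then obtain B where AB: "A + B = ab_type G" "A \<inter># B = {#}" by (auto simp: P_def)
    have "primepow q" if "q \<in># A + B" for q using that primepow_ab_type[OF assms] AB by auto
    then obtain H K :: "nat monoid" where "fin_ab_group H" "ab_type H = A" "fin_ab_group K" "ab_type K = B"
      using exists_nat_group_of_ab_type[of A] exists_nat_group_of_ab_type[of B] by auto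
    moreover from this have "unitary_factors G H K" using AB by (simp add: unitary_factors_iff[OF assms])
    ultimately show "A \<in> ab_type ` X" by (auto simp: X_def)
  qed
  moreover have "inj_on fst P" by (auto simp: inj_on_def P_def) (metis add_left_cancel)
  ultimately have "card (ab_type ` X) = card P" by (simp add: card_image)
  moreover have "card (X // ab_iso) = card (ab_type ` X)"
    using quotient_ab_iso[OF fin] by (simp add: card_image)
  ultimately show ?thesis by (simp add: num_unitary_factors_def X_def P_def)
qed

subsection \<open>The rank of the conjugate group\<close>

text \<open>The whole carrier is a finite generating set, so the minimum defining the rank is
  attained.\<close>

lemma group_rank_le_iff:
  assumes "group G" "finite (carrier G)"
  shows "group_rank G \<le> r \<longleftrightarrow>
    (\<exists>S. S \<subseteq> carrier G \<and> finite S \<and> card S \<le> r \<and> generate G S = carrier G)"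
proof
  have "generate G (carrier G) = carrier G"
    using assms(1) group.generate_incl[OF assms(1), of "carrier G"] by (auto intro: generate.incl)
  then have "\<exists>k S. S \<subseteq> carrier G \<and> finite S \<and> card S = k \<and> generate G S = carrier G"
    using assms(2) by blast
  then have "\<exists>S. S \<subseteq> carrier G \<and> finite S \<and> card S = group_rank G \<and> generate G S = carrier G"
    unfolding group_rank_def by (rule LeastI_ex)
  moreover assume "group_rank G \<le> r"
  ultimately show "\<exists>S. S \<subseteq> carrier G \<and> finite S \<and> card S \<le> r \<and> generate G S = carrier G"
    by metis
next
  assume "\<exists>S. S \<subseteq> carrier G \<and> finite S \<and> card S \<le> r \<and> generate G S = carrier G"
  then obtain S where S: "S \<subseteq> carrier G" "finite S" "card S \<le> r" "generate G S = carrier G" by blast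
  then have "group_rank G \<le> card S"
    unfolding group_rank_def by (intro Least_le) blast
  with S show "group_rank G \<le> r" by simp
qed

lemma group_group_of_type [simp]: "group (group_of_type p l)"
  by (simp add: group_of_type_def)

text \<open>Later \<open>P\<close> consists of the primes dividing the order of a group, and
  \<open>\<mu> p\<close> is the conjugate of its partition at \<open>p\<close>. Zero parts are
  excluded because they would lengthen a partition without raising the rank.\<close>

context
  fixes P :: "nat set" and \<mu> :: "nat \<Rightarrow> nat list" and G :: "(nat \<Rightarrow> nat \<Rightarrow> int) monoid"
  assumes finP: "finite P" and primeP: "\<And>p. p \<in> P \<Longrightarrow> prime p"
    and nz: "\<And>p. p \<in> P \<Longrightarrow> 0 \<notin> set (\<mu> p)"
  defines "G \<equiv> product_group P (\<lambda>p. group_of_type p (\<mu> p))"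
begin

lemma group_product_of_types: "group G"
  by (simp add: G_def)

lemma modulus_gt_1: "p \<in> P \<Longrightarrow> i < length (\<mu> p) \<Longrightarrow> p ^ (\<mu> p ! i) > 1"
  using nz[of p] primeP[of p] nth_mem[of i "\<mu> p"]
  by (metis not_gr0 one_less_power prime_gt_1_nat)

lemma modulus_gt_1_int: "p \<in> P \<Longrightarrow> i < length (\<mu> p) \<Longrightarrow> int (p ^ (\<mu> p ! i)) > 1"
  using modulus_gt_1 by (metis of_nat_1 of_nat_less_iff)

lemma carrier_product_of_types:
  "carrier G = (\<Pi>\<^sub>E p\<in>P. \<Pi>\<^sub>E i\<in>{..<length (\<mu> p)}. {0..<int (p ^ (\<mu> p ! i))})"
  unfolding G_def group_of_type_def carrier_product_group
proof (intro PiE_cong)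
  fix p i assume p: "p \<in> P" "i \<in> {..<length (\<mu> p)}"
  then have "p ^ (\<mu> p ! i) > 1" using modulus_gt_1[of p i] by simp
  then have "p ^ (\<mu> p ! i) \<noteq> 0" by linarith
  then show "carrier (integer_mod_group (p ^ (\<mu> p ! i))) = {0..<int (p ^ (\<mu> p ! i))}"
    unfolding carrier_integer_mod_group by (rule if_not_P)
qed

lemma finite_product_of_types: "finite (carrier G)"
  unfolding carrier_product_of_types by (intro finite_PiE finP) auto

lemma mult_product_of_types:
  "x \<otimes>\<^bsub>G\<^esub> y = (\<lambda>p\<in>P. \<lambda>i\<in>{..<length (\<mu> p)}. (x p i + y p i) mod int (p ^ (\<mu> p ! i)))"
  by (simp add: G_def group_of_type_def)

lemma one_product_of_types: "\<one>\<^bsub>G\<^esub> = (\<lambda>p\<in>P. \<lambda>i\<in>{..<length (\<mu> p)}. 0)"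
  by (simp add: G_def group_of_type_def)

lemma pow_product_of_types:
  assumes "x \<in> carrier G"
  shows "x [^]\<^bsub>G\<^esub> (n::nat) = (\<lambda>p\<in>P. \<lambda>i\<in>{..<length (\<mu> p)}. (int n * x p i) mod int (p ^ (\<mu> p ! i)))"
proof -
  have "x [^]\<^bsub>G\<^esub> n = (\<lambda>p\<in>P. x p [^]\<^bsub>group_of_type p (\<mu> p)\<^esub> n)"
    using assms unfolding G_def by (intro pow_product_group) auto
  also have "\<dots> = (\<lambda>p\<in>P. \<lambda>i\<in>{..<length (\<mu> p)}. (int n * x p i) mod int (p ^ (\<mu> p ! i)))"
  proof (rule restrict_ext)
    fix p assume p: "p \<in> P"
    have "x p \<in> carrier (group_of_type p (\<mu> p))" using assms p by (auto simp: G_def)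
    then show "x p [^]\<^bsub>group_of_type p (\<mu> p)\<^esub> n =
        (\<lambda>i\<in>{..<length (\<mu> p)}. (int n * x p i) mod int (p ^ (\<mu> p ! i)))"
      unfolding group_of_type_def by (subst pow_product_group) auto
  qed
  finally show ?thesis .
qed

lemma inv_product_of_types:
  assumes "x \<in> carrier G" "p \<in> P" "i < length (\<mu> p)"
  shows "(inv\<^bsub>G\<^esub> x) p i = (- x p i) mod int (p ^ (\<mu> p ! i))"
proof -
  have xp: "x p \<in> carrier (group_of_type p (\<mu> p))" using assms by (auto simp: G_def)
  have 1: "(inv\<^bsub>G\<^esub> x) p = inv\<^bsub>group_of_type p (\<mu> p)\<^esub> (x p)"
    using assms unfolding G_def by (subst inv_product_group) auto
  have "(inv\<^bsub>group_of_type p (\<mu> p)\<^esub> (x p)) i = inv\<^bsub>integer_mod_group (p ^ (\<mu> p ! i))\<^esub> (x p i)"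
    using xp assms unfolding group_of_type_def by (subst inv_product_group) auto
  also have "\<dots> = (- x p i) mod int (p ^ (\<mu> p ! i))"
    using xp assms by (intro inv_integer_mod_group) (auto simp: group_of_type_def)
  finally show ?thesis by (simp add: 1)
qed

text \<open>The \<open>j\<close>-th generator has a one in position \<open>j\<close> for every prime simultaneously; the Chinese
  remainder theorem lets its powers adjust all primes independently.\<close>
lemma generators_product_of_types:
  assumes len: "\<And>p. p \<in> P \<Longrightarrow> length (\<mu> p) \<le> r"
  shows "\<exists>S. S \<subseteq> carrier G \<and> finite S \<and> card S \<le> r \<and> generate G S = carrier G"
proof -
  interpret group G by (rule group_product_of_types)
  define e where "e = (\<lambda>j. \<lambda>p\<in>P. \<lambda>i\<in>{..<length (\<mu> p)}. if i = j then 1 else 0 :: int)"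
  have e: "e j \<in> carrier G" for j
    unfolding carrier_product_of_types e_def
  proof (intro restrict_PiE_iff[THEN iffD2] ballI)
    fix p i assume "p \<in> P" "i \<in> {..<length (\<mu> p)}"
    then have "1 < int (p ^ (\<mu> p ! i))" using modulus_gt_1_int[of p i] by blast
    then show "(if i = j then 1 else 0) \<in> {0..<int (p ^ (\<mu> p ! i))}"
      unfolding atLeastLessThan_iff by presburger
  qed
  define S where "S = e ` {..<r}"
  have sub: "subgroup (generate G S) G" using e by (intro generate_is_subgroup) (auto simp: S_def)
  have "carrier G \<subseteq> generate G S"
  proof
    fix x assume x: "x \<in> carrier G"
    \<comment> \<open>\<open>y k\<close> agrees with \<open>x\<close> in the first \<open>k\<close>
      positions at every prime and is 0 beyond. Going to \<open>Suc k\<close> costs one power of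
      \<open>e k\<close>.\<close>
    define y where "y = (\<lambda>k. \<lambda>p\<in>P. \<lambda>i\<in>{..<length (\<mu> p)}. if i < k then x p i else 0)"
    have "k \<le> r \<Longrightarrow> y k \<in> generate G S" for k
    proof (induction k)
      case 0
      have "y 0 = \<one>\<^bsub>G\<^esub>" by (simp add: y_def one_product_of_types)
      then show ?case using generate.one by metis
    next
      case (Suc k)
      \<comment> \<open>At primes with at most \<open>k\<close> parts, \<open>\<mu> p ! k\<close> is
        an unspecified value. The moduli are powers of distinct primes all the same, hence coprime,
        and the congruence for \<open>c\<close> is only evaluated where position \<open>k\<close>
        exists.\<close>
      have "\<forall>p\<in>P. \<forall>p'\<in>P. p \<noteq> p' \<longrightarrow> coprime (p ^ (\<mu> p ! k)) (p' ^ (\<mu> p' ! k))"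
        using primeP by (simp add: primes_coprime)
      then obtain c where c: "\<And>p. p \<in> P \<Longrightarrow> [c = nat (x p k)] (mod p ^ (\<mu> p ! k))"
        using chinese_remainder_nat[OF finP, of "\<lambda>p. p ^ (\<mu> p ! k)" "\<lambda>p. nat (x p k)"] by blast
      have xr: "0 \<le> x p i" "x p i < int (p ^ (\<mu> p ! i))" if "p \<in> P" "i < length (\<mu> p)" for p i
        using x that unfolding carrier_product_of_types by (auto simp: PiE_iff)
      have cx: "int c mod int (p ^ (\<mu> p ! k)) = x p k" if "p \<in> P" "k < length (\<mu> p)" for p
      proof -
        have "int c mod int (p ^ (\<mu> p ! k)) = int (nat (x p k)) mod int (p ^ (\<mu> p ! k))"
          using c[OF that(1)] unfolding cong_def by (metis of_nat_mod)
        then show ?thesis using xr[OF that] by simp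
      qed
      have "y (Suc k) = y k \<otimes>\<^bsub>G\<^esub> (e k [^]\<^bsub>G\<^esub> c)"
        unfolding mult_product_of_types pow_product_of_types[OF e]
      proof (unfold y_def, intro restrict_ext)
        fix p i assume p: "p \<in> P" and "i \<in> {..<length (\<mu> p)}"
        then have i: "i < length (\<mu> p)" by simp
        consider "i < k" | "i = k" | "i > k" by linarith
        then show "(if i < Suc k then x p i else 0) =
          ((\<lambda>p\<in>P. \<lambda>i\<in>{..<length (\<mu> p)}. if i < k then x p i else 0) p i +
           (\<lambda>p\<in>P. \<lambda>i\<in>{..<length (\<mu> p)}. int c * e k p i mod int (p ^ (\<mu> p ! i))) p i) mod int (p ^ (\<mu> p ! i))"
        proof cases
          case 1
          then show ?thesis using p i xr[OF p i] by (simp add: e_def del: of_nat_power)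
        next
          case 2
          then show ?thesis using p i cx[OF p] xr[OF p i] by (simp add: e_def del: of_nat_power)
        next
          case 3
          then show ?thesis using p i by (simp add: e_def)
        qed
      qed
      moreover have "e k \<in> generate G S" using Suc.prems by (intro generate.incl) (simp add: S_def)
      then have "e k [^]\<^bsub>G\<^esub> c \<in> generate G S"
        using subgroup_int_pow_closed[OF sub, of "e k" "int c"] by (simp add: int_pow_int)
      ultimately show ?case using Suc subgroup.m_closed[OF sub] by simp
    qed
    then have "y r \<in> generate G S" by simp
    moreover have "y r = x"
    proof (rule extensionalityI[of _ P])
      show "x \<in> extensional P" using x unfolding carrier_product_of_types by (auto simp: PiE_iff)
      fix p assume p: "p \<in> P"
      show "y r p = x p"
      proof (rule extensionalityI[of _ "{..<length (\<mu> p)}"])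
        show "x p \<in> extensional {..<length (\<mu> p)}"
          using x p unfolding carrier_product_of_types by (auto simp: PiE_iff)
      qed (use p len[OF p] in \<open>auto simp: y_def\<close>)
    qed (simp add: y_def)
    ultimately show "x \<in> generate G S" by simp
  qed
  moreover have "generate G S \<subseteq> carrier G" using subgroup.subset[OF sub] .
  moreover have "card S \<le> r" unfolding S_def using card_image_le[of "{..<r}" e] by simp
  ultimately show ?thesis using e by (intro exI[of _ S]) (auto simp: S_def)
qed

text \<open>A count modulo \<open>p\<close>. Since \<open>p\<close> divides every modulus at
  \<open>p\<close>, the \<open>p\<close>-component of a generated element is modulo \<open>p\<close>
  a linear combination of those of the generators, with coefficients that matter only modulo
  \<open>p\<close>. So \<open>p ^ card S\<close> coefficient vectors must reach all
  \<open>p ^ length (\<mu> p)\<close> residue vectors.\<close>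

lemma card_generators_product_of_types:
  assumes S: "S \<subseteq> carrier G" "finite S" "generate G S = carrier G" and p: "p \<in> P"
  shows "length (\<mu> p) \<le> card S"
proof -
  interpret group G by (rule group_product_of_types)
  define m where "m = length (\<mu> p)"
  have dvd: "int p dvd int (p ^ (\<mu> p ! i))" if "i < m" for i
    using modulus_gt_1[OF p, of i] that by (cases "\<mu> p ! i") (auto simp: m_def)
  have gen: "\<exists>c. \<forall>i<m. x p i mod int p = (\<Sum>s\<in>S. c s * s p i) mod int p" if "x \<in> generate G S" for x
    using that
  proof induction
    case one
    then show ?case using p by (intro exI[of _ "\<lambda>_. 0"]) (simp add: one_product_of_types m_def)
  next
    case (incl h)
    have "(\<Sum>s\<in>S. (if s = h then 1 else 0) * s p i) = h p i" for i
      using incl S(2) by (simp add: if_distrib[of "\<lambda>c. c * _"] cong: if_cong)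
    then show ?case by (intro exI[of _ "\<lambda>s. if s = h then 1 else 0"]) simp
  next
    case (inv h)
    have 1: "(\<Sum>s\<in>S. (if s = h then - 1 else 0) * s p i) = - h p i" for i
      using inv S(2) by (simp add: if_distrib[of "\<lambda>c. c * _"] cong: if_cong)
    have "(inv\<^bsub>G\<^esub> h) p i mod int p = (- h p i) mod int p" if "i < m" for i
      using inv_product_of_types[of h p i] inv S(1) p that
      by (auto simp: m_def mod_mod_cancel[OF dvd[OF that]] simp del: of_nat_power)
    with 1 show ?case by (intro exI[of _ "\<lambda>s. if s = h then - 1 else 0"]) simp
  next
    case (eng x y)
    then obtain c d where c: "\<forall>i<m. x p i mod int p = (\<Sum>s\<in>S. c s * s p i) mod int p"
      and d: "\<forall>i<m. y p i mod int p = (\<Sum>s\<in>S. d s * s p i) mod int p" by blast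
    have "(x \<otimes>\<^bsub>G\<^esub> y) p i mod int p = (\<Sum>s\<in>S. (c s + d s) * s p i) mod int p" if "i < m" for i
    proof -
      have "(x \<otimes>\<^bsub>G\<^esub> y) p i mod int p = (x p i + y p i) mod int p"
        using p that by (simp add: mult_product_of_types m_def mod_mod_cancel[OF dvd[OF that]] del: of_nat_power)
      also have "\<dots> = ((\<Sum>s\<in>S. c s * s p i) + (\<Sum>s\<in>S. d s * s p i)) mod int p"
        using c d that by (intro mod_add_cong) auto
      finally show ?thesis by (simp add: distrib_right sum.distrib)
    qed
    then show ?case by (intro exI[of _ "\<lambda>s. c s + d s"]) simp
  qed
  have p1: "p > 1" using prime_gt_1_nat[OF primeP[OF p]] .
  define F where "F = (\<lambda>c. \<lambda>i\<in>{..<m}. (\<Sum>s\<in>S. c s * s p i) mod int p)"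
  have "({..<m} \<rightarrow>\<^sub>E {0..<int p}) \<subseteq> F ` (S \<rightarrow>\<^sub>E {0..<int p})"
  proof
    fix v assume v: "v \<in> {..<m} \<rightarrow>\<^sub>E {0..<int p}"
    define x where "x = (\<lambda>p'\<in>P. \<lambda>i\<in>{..<length (\<mu> p')}. if p' = p then v i else 0)"
    have "x \<in> carrier G"
      unfolding carrier_product_of_types x_def
    proof (intro restrict_PiE_iff[THEN iffD2] ballI)
      fix p' i assume p': "p' \<in> P" "i \<in> {..<length (\<mu> p')}"
      show "(if p' = p then v i else 0) \<in> {0..<int (p' ^ (\<mu> p' ! i))}"
      proof (cases "p' = p")
        case True
        then have i: "i < m" using p' by (simp add: m_def)
        then have "int p \<le> int (p ^ (\<mu> p ! i))"
          using dvd[OF i] p1 by (intro zdvd_imp_le) auto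
        moreover have "0 \<le> v i" "v i < int p" using v i by (auto simp: PiE_iff)
        ultimately show ?thesis using True by (simp del: of_nat_power)
      next
        case False
        then have "1 < int (p' ^ (\<mu> p' ! i))" using modulus_gt_1_int[of p' i] p' by blast
          then show ?thesis using False unfolding atLeastLessThan_iff by presburger
      qed
    qed
    then obtain c where c: "\<forall>i<m. x p i mod int p = (\<Sum>s\<in>S. c s * s p i) mod int p"
      using gen S(3) by blast
    define c' where "c' = (\<lambda>s\<in>S. c s mod int p)"
    have "c' \<in> S \<rightarrow>\<^sub>E {0..<int p}" using p1 by (auto simp: c'_def)
    moreover have "v = F c'"
    proof (rule extensionalityI[of _ "{..<m}"])
      show "v \<in> extensional {..<m}" using v by (auto simp: PiE_iff)
      show "F c' \<in> extensional {..<m}" by (simp add: F_def)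
      fix i assume "i \<in> {..<m}"
      then have i: "i < m" by simp
      have "v i = v i mod int p" using v i by (auto simp: PiE_iff)
      also have "\<dots> = (\<Sum>s\<in>S. c s * s p i) mod int p" using c i p by (simp add: x_def m_def)
      also have "\<dots> = (\<Sum>s\<in>S. (c s * s p i) mod int p) mod int p" by (simp add: mod_sum_eq)
      also have "\<dots> = (\<Sum>s\<in>S. (c' s * s p i) mod int p) mod int p"
        by (rule arg_cong[where f = "\<lambda>t. t mod int p", OF sum.cong[OF refl]])
          (simp add: c'_def mod_mult_left_eq)
      also have "\<dots> = F c' i" using i by (simp add: F_def mod_sum_eq)
      finally show "v i = F c' i" .
    qed
    ultimately show "v \<in> F ` (S \<rightarrow>\<^sub>E {0..<int p})" by blast
  qed
  moreover have fin: "finite (S \<rightarrow>\<^sub>E {0..<int p})" using S(2) by (intro finite_PiE) auto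
  ultimately have "card ({..<m} \<rightarrow>\<^sub>E {0..<int p}) \<le> card (F ` (S \<rightarrow>\<^sub>E {0..<int p}))"
    by (intro card_mono) auto
  also have "\<dots> \<le> card (S \<rightarrow>\<^sub>E {0..<int p})" by (rule card_image_le[OF fin])
  finally have "p ^ m \<le> p ^ card S" using S(2) by (simp add: card_PiE)
  then show ?thesis using p1 by (simp add: m_def)
qed

lemma group_rank_product_of_types:
  "group_rank G \<le> r \<longleftrightarrow> (\<forall>p\<in>P. length (\<mu> p) \<le> r)"
proof
  assume "group_rank G \<le> r"
  then obtain S where "S \<subseteq> carrier G" "finite S" "card S \<le> r" "generate G S = carrier G"
    using group_rank_le_iff[OF group_product_of_types finite_product_of_types] by blast
  then show "\<forall>p\<in>P. length (\<mu> p) \<le> r"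
    using card_generators_product_of_types le_trans by blast
next
  assume "\<forall>p\<in>P. length (\<mu> p) \<le> r"
  then show "group_rank G \<le> r"
    using generators_product_of_types group_rank_le_iff[OF group_product_of_types finite_product_of_types]
    by blast
qed

end

section \<open>Primary components, their partitions and the conjugate group\<close>

lemma group_of_type_eq_cyclic_product: "group_of_type p l = cyclic_product (map (\<lambda>a. p ^ a) l)"
  unfolding group_of_type_def cyclic_product_def product_group_def
  by (auto simp: fun_eq_iff intro!: PiE_cong)

text \<open>Uniqueness of types resolves the description: the exponent of a power of
  \<open>p\<close> is determined, and a sorted list is determined by its multiset.\<close>

lemma type_of_pgroup_eqI:
  assumes p: "prime p" and l: "sorted l" "0 \<notin> set l"
    and type: "has_type G (image_mset (\<lambda>a. p ^ a) (mset l))"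
  shows "type_of_pgroup p G = l"
  unfolding type_of_pgroup_def
proof (rule the_equality)
  show "sorted l \<and> 0 \<notin> set l \<and> G \<cong> group_of_type p l"
    using l has_type_imp_iso[OF type] has_type_cyclic_product[of "map (\<lambda>a. p ^ a) l"]
    by (simp add: group_of_type_eq_cyclic_product)
next
  fix k assume k: "sorted k \<and> 0 \<notin> set k \<and> G \<cong> group_of_type p k"
  have inj: "inj (\<lambda>a. p ^ a)" using prime_gt_1_nat[OF p] by (simp add: inj_def)
  have "has_type G (mset (map (\<lambda>a. p ^ a) k))"
    unfolding has_type_def using has_type_group[OF type] k group_of_type_eq_cyclic_product by metis
  then have "mset (map (\<lambda>a. p ^ a) k) = image_mset (\<lambda>a. p ^ a) (mset l)"
    using type by (rule has_type_unique) (use p k l in \<open>auto intro!: primepow_prime_power gr0I\<close>)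
  then have "image_mset (\<lambda>a. p ^ a) (mset k) = image_mset (\<lambda>a. p ^ a) (mset l)" by simp
  then have "mset k = mset l" using multiset.inj_map[OF inj] by (auto dest: injD)
  then show "k = l" using k l by (metis properties_for_sort)
qed

text \<open>Both multisets have the same gcd products. For powers of \<open>p\<close> the component
  contains all the torsion of \<open>G\<close>, and entries prime to \<open>p\<close> contribute 1.
  For powers of another prime only the identity remains, and so do only factors 1.\<close>

lemma primary_component_ab_type:
  assumes G: "fin_ab_group G" and p: "prime (p::nat)"
  shows "fin_ab_group (primary_component p G)"
    and "ab_type (primary_component p G) = filter_mset (\<lambda>q. p dvd q) (ab_type G)"
proof -
  interpret comm_group G using G by (simp add: fin_ab_group_def)
  define C where "C = {x \<in> carrier G. \<exists>k::nat. x [^]\<^bsub>G\<^esub> (p ^ k) = \<one>\<^bsub>G\<^esub>}"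
  have pc: "primary_component p G = G\<lparr>carrier := C\<rparr>"
    by (simp add: primary_component_def C_def)
  have sub: "subgroup C G"
  proof (rule subgroupI)
    show "C \<subseteq> carrier G" by (auto simp: C_def)
    show "C \<noteq> {}" by (auto simp: C_def intro!: exI[of _ "\<one>\<^bsub>G\<^esub>"])
    show "inv\<^bsub>G\<^esub> x \<in> C" if "x \<in> C" for x using that by (auto simp: C_def nat_pow_inv)
    show "x \<otimes>\<^bsub>G\<^esub> y \<in> C" if xy: "x \<in> C" "y \<in> C" for x y
    proof -
      obtain k j where kj: "x [^]\<^bsub>G\<^esub> (p ^ k) = \<one>\<^bsub>G\<^esub>" "y [^]\<^bsub>G\<^esub> (p ^ j) = \<one>\<^bsub>G\<^esub>"
        and c: "x \<in> carrier G" "y \<in> carrier G"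
        using xy by (auto simp: C_def)
      have "x [^]\<^bsub>G\<^esub> (p ^ (k + j)) = \<one>\<^bsub>G\<^esub>" "y [^]\<^bsub>G\<^esub> (p ^ (j + k)) = \<one>\<^bsub>G\<^esub>"
        using kj c by (simp_all add: power_add nat_pow_pow[symmetric])
      then have "(x \<otimes>\<^bsub>G\<^esub> y) [^]\<^bsub>G\<^esub> (p ^ (k + j)) = \<one>\<^bsub>G\<^esub>"
        using c by (simp add: nat_pow_distrib add.commute)
      then show ?thesis using c by (auto simp: C_def)
    qed
  qed
  show fin: "fin_ab_group (primary_component p G)"
    unfolding pc fin_ab_group_def
    using comm_group_subgroup[OF comm_group_axioms sub] G subgroup.subset[OF sub]
    by (auto simp: fin_ab_group_def intro: finite_subset)
  have tc: "torsion_card (primary_component p G) d = card {x \<in> C. x [^]\<^bsub>G\<^esub> d = \<one>\<^bsub>G\<^esub>}" for d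
    unfolding torsion_card_def pc by (simp add: nat_pow_consistent[symmetric])
  have prod: "(\<Prod>q\<in>#filter_mset (\<lambda>q. p dvd q) M. gcd (p ^ j) q) = (\<Prod>q\<in>#M. gcd (p ^ j) q)"
    for j and M :: "nat multiset"
  proof (induction M)
    case (add q M)
    have "gcd (p ^ j) q = 1" if "\<not> p dvd q"
      using that p by (metis coprime_iff_gcd_eq_1 coprime_power_left_iff prime_imp_coprime)
    then show ?case using add by auto
  qed simp
  show "ab_type (primary_component p G) = filter_mset (\<lambda>q. p dvd q) (ab_type G)"
  proof (rule prime_power_mset_eqI)
    fix p' j :: nat assume p': "prime p'"
    show "(\<Prod>q\<in>#ab_type (primary_component p G). gcd (p' ^ j) q) =
        (\<Prod>q\<in>#filter_mset (\<lambda>q. p dvd q) (ab_type G). gcd (p' ^ j) q)"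
    proof (cases "p' = p")
      case True
      have "{x \<in> C. x [^]\<^bsub>G\<^esub> (p ^ j) = \<one>\<^bsub>G\<^esub>} = {x \<in> carrier G. x [^]\<^bsub>G\<^esub> (p ^ j) = \<one>\<^bsub>G\<^esub>}"
        by (auto simp: C_def)
      then have "torsion_card (primary_component p G) (p ^ j) = torsion_card G (p ^ j)"
        unfolding tc by (simp add: torsion_card_def)
      then show ?thesis
        unfolding True prod by (simp add: torsion_card_ab_type[OF fin] torsion_card_ab_type[OF G])
    next
      case False
      then have cop: "coprime (p' ^ j) (p ^ k)" for k using p p' by (simp add: primes_coprime)
      have "{x \<in> C. x [^]\<^bsub>G\<^esub> (p' ^ j) = \<one>\<^bsub>G\<^esub>} = {\<one>\<^bsub>G\<^esub>}"
      proof (intro equalityI subsetI)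
        fix x assume x: "x \<in> {x \<in> C. x [^]\<^bsub>G\<^esub> (p' ^ j) = \<one>\<^bsub>G\<^esub>}"
        then obtain k where "x [^]\<^bsub>G\<^esub> (p ^ k) = \<one>\<^bsub>G\<^esub>" and c: "x \<in> carrier G" by (auto simp: C_def)
        then have "ord x dvd p ^ k" "ord x dvd p' ^ j" using x by (auto simp: pow_eq_id)
        then have "ord x = 1" using cop[of k] coprime_common_divisor_nat by blast
        then show "x \<in> {\<one>\<^bsub>G\<^esub>}" using c ord_eq_1 by simp
      qed (auto simp: C_def)
      then have "torsion_card (primary_component p G) (p' ^ j) = 1" unfolding tc by simp
      moreover have "gcd (p' ^ j) q = 1" if q: "q \<in># ab_type G" "p dvd q" for q
      proof -
        have "p ^ 1 dvd q" using q by simp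
        then obtain k where "q = p ^ k"
          using primepow_nat_dvd_cases[OF primepow_ab_type[OF G q(1)] p, of 1] by auto
        then show ?thesis using cop by (simp add: coprime_iff_gcd_eq_1)
      qed
      then have "(\<Prod>q\<in>#filter_mset (\<lambda>q. p dvd q) (ab_type G). gcd (p' ^ j) q) = 1"
        by (intro prod_mset.neutral) auto
      ultimately show ?thesis by (simp add: torsion_card_ab_type[OF fin])
    qed
  qed (use primepow_ab_type[OF fin] primepow_ab_type[OF G] in auto)
qed

lemma type_of_primary_component:
  assumes G: "fin_ab_group G" and p: "prime (p::nat)"
  defines "l \<equiv> type_of_pgroup p (primary_component p G)"
  shows "0 \<notin> set l" "image_mset (\<lambda>a. p ^ a) (mset l) = filter_mset (\<lambda>q. p dvd q) (ab_type G)"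
proof -
  define M where "M = filter_mset (\<lambda>q. p dvd q) (ab_type G)"
  define k where "k = sorted_list_of_multiset (image_mset (multiplicity p) M)"
  have pw: "\<exists>a>0. q = p ^ a" if "q \<in># M" for q
  proof -
    have q: "q \<in># ab_type G" "p ^ 1 dvd q" using that by (auto simp: M_def)
    show ?thesis using primepow_nat_dvd_cases[OF primepow_ab_type[OF G q(1)] p q(2)]
      by (metis less_le_trans zero_less_one)
  qed
  have mult: "multiplicity p (p ^ a) = a" for a using p by simp
  have "image_mset (\<lambda>a. p ^ a) (image_mset (multiplicity p) M) = image_mset (\<lambda>q. q) M"
    unfolding multiset.map_comp
  proof (intro image_mset_cong)
    fix q assume "q \<in># M"
    then show "((\<lambda>a. p ^ a) \<circ> multiplicity p) q = q" using pw[of q] by (auto simp: mult)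
  qed
  then have img: "image_mset (\<lambda>a. p ^ a) (mset k) = M" by (simp add: k_def)
  have "multiplicity p q \<noteq> 0" if "q \<in># M" for q using pw[OF that] by (auto simp: mult)
  then have k0: "0 \<notin> set k" by (force simp: k_def)
  have "has_type (primary_component p G) M"
    using has_type_ab_type primary_component_ab_type[OF G p] by (metis M_def)
  then have "l = k"
    unfolding l_def using img k0 p by (intro type_of_pgroup_eqI) (auto simp: k_def)
  then show "0 \<notin> set l" "image_mset (\<lambda>a. p ^ a) (mset l) = filter_mset (\<lambda>q. p dvd q) (ab_type G)"
    using k0 img by (auto simp: M_def)
qed

lemma length_conj_partition: "length (conj_partition l) = Max (insert 0 (set l))"
  by (simp add: conj_partition_def)

text \<open>For each \<open>j\<close> in the range the largest part is itself among the parts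
  counted.\<close>

lemma conj_partition_nonzero: "0 \<notin> set (conj_partition l)"
proof
  assume "0 \<in> set (conj_partition l)"
  then obtain j where j: "1 \<le> j" "j \<le> Max (insert 0 (set l))" "filter (\<lambda>a. j \<le> a) l = []"
    by (auto simp: conj_partition_def less_Suc_eq_le)
  have "Max (insert 0 (set l)) \<in> insert 0 (set l)" by (intro Max_in) auto
  then have "Max (insert 0 (set l)) \<in> set l" using j by auto
  then show False using j by (auto simp: filter_empty_conv)
qed

lemma group_rank_conjugate_group_le_iff:
  assumes G: "fin_ab_group G"
  shows "group_rank (conjugate_group G) \<le> r \<longleftrightarrow> ab_type G \<in> msets_over (prime_powers_upto r)"
proof -
  define P where "P = {p. prime p \<and> p dvd order G}"
  define l where "l = (\<lambda>p. type_of_pgroup p (primary_component p G))"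
  interpret comm_group G using G by (simp add: fin_ab_group_def)
  have "order G > 0" using G by (simp add: fin_ab_group_def order_gt_0_iff_finite)
  then have finP: "finite P" unfolding P_def by (intro finite_subset[OF _ finite_divisors_nat]) auto
  have l: "0 \<notin> set (l p)" "image_mset (\<lambda>a. p ^ a) (mset (l p)) = filter_mset (\<lambda>q. p dvd q) (ab_type G)"
    if "prime p" for p
    using type_of_primary_component[OF G that] by (simp_all add: l_def)
  have "conjugate_group G = product_group P (\<lambda>p. group_of_type p (conj_partition (l p)))"
    by (simp add: conjugate_group_def conjugate_pgroup_def P_def l_def)
  then have "group_rank (conjugate_group G) \<le> r \<longleftrightarrow> (\<forall>p\<in>P. length (conj_partition (l p)) \<le> r)"
    using group_rank_product_of_types[OF finP, of "\<lambda>p. conj_partition (l p)"] conj_partition_nonzero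
    by (simp add: P_def)
  also have "\<dots> \<longleftrightarrow> (\<forall>p\<in>P. \<forall>a\<in>set (l p). a \<le> r)"
    by (simp add: length_conj_partition)
  also have "\<dots> \<longleftrightarrow> ab_type G \<in> msets_over (prime_powers_upto r)"
  proof
    assume le: "\<forall>p\<in>P. \<forall>a\<in>set (l p). a \<le> r"
    have "q \<in> prime_powers_upto r" if q: "q \<in># ab_type G" for q
    proof -
      obtain p k where pk: "prime p" "k > 0" "q = p ^ k"
        using primepow_ab_type[OF G q] by (auto simp: primepow_def)
      \<comment> \<open>The assumed bound speaks only of primes dividing the order; each entry of
        the type divides the order, so its prime is among them.\<close>
      have "q dvd order G" using dvd_prod_mset[OF q] by (simp add: order_ab_type[OF G])
      then have "p \<in> P" using pk by (auto simp: P_def intro: dvd_trans[OF dvd_power])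
      have "q \<in># image_mset (\<lambda>a. p ^ a) (mset (l p))" using q pk by (simp add: l(2)[OF pk(1)])
      then obtain a where "a \<in> set (l p)" "p ^ k = p ^ a" using pk by auto
      then have "k \<in> set (l p)" using prime_power_eq_nat_iff[OF pk(1) pk(1) pk(2), of a] by simp
      then have "k \<le> r" using le \<open>p \<in> P\<close> by blast
      then show ?thesis
        unfolding prime_powers_upto_def using pk
        by (metis (mono_tags, lifting) mem_Collect_eq Suc_leI One_nat_def)
    qed
    then show "ab_type G \<in> msets_over (prime_powers_upto r)" by (auto simp: msets_over_def)
  next
    assume M: "ab_type G \<in> msets_over (prime_powers_upto r)"
    show "\<forall>p\<in>P. \<forall>a\<in>set (l p). a \<le> r"
    proof (intro ballI)
      fix p a assume p: "p \<in> P" and a: "a \<in> set (l p)"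
      have pr: "prime p" using p by (simp add: P_def)
      have "p ^ a \<in># filter_mset (\<lambda>q. p dvd q) (ab_type G)"
        using a by (simp flip: l(2)[OF pr])
      then have "p ^ a \<in> prime_powers_upto r" using M by (auto simp: msets_over_def)
      then obtain p' j where "prime p'" "j \<le> r" "p ^ a = p' ^ j" by (auto simp: prime_powers_upto_def)
      moreover have "a > 0" using l(1)[OF pr] a by (metis gr0I)
      ultimately show "a \<le> r" using prime_power_eq_nat_iff[OF pr] by metis
    qed
  qed
  finally show ?thesis .
qed

subsection \<open>Counting unitary factors\<close>

text \<open>A disjoint pair \<open>(A, B)\<close> determines the type \<open>A + B\<close> of the
  group it splits, so the sum over types of the numbers of splittings counts each pair once. Any
  representative of a class has the same type, which makes the choice by \<open>SOME\<close>
  harmless.\<close>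

lemma unitary_count_eq:
  assumes "n > 0"
  shows "unitary_count r n = card {(A, B) \<in> disjoint_pairs (prime_powers_upto r). \<Prod>\<^sub># A * \<Prod>\<^sub># B = n}"
proof -
  let ?Q = "prime_powers_upto r"
  define X where "X = {G :: nat monoid. fin_ab_group G \<and> order G = n \<and> group_rank (conjugate_group G) \<le> r}"
  define T where "T = {M \<in> msets_over ?Q. \<Prod>\<^sub># M = n}"
  define P where "P = (\<lambda>M :: nat multiset. {(A, B). A + B = M \<and> A \<inter># B = {#}})"
  define cls where "cls = (\<lambda>M. {G :: nat monoid. fin_ab_group G \<and> ab_type G = M})"
  have fin: "fin_ab_group G" if "G \<in> X" for G using that by (simp add: X_def)
  have primepow: "primepow q" if "M \<in> T" "q \<in># M" for M q
    using that by (force simp: T_def msets_over_def prime_powers_upto_def)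
  have "ab_type ` X = T"
  proof (intro equalityI subsetI)
    fix M assume "M \<in> ab_type ` X"
    then show "M \<in> T" by (auto simp: X_def T_def group_rank_conjugate_group_le_iff order_ab_type)
  next
    fix M assume M: "M \<in> T"
    obtain G :: "nat monoid" where "fin_ab_group G" "ab_type G = M"
      using exists_nat_group_of_ab_type[of M] primepow[OF M] by blast
    then have "G \<in> X"
      using M by (simp add: X_def T_def group_rank_conjugate_group_le_iff order_ab_type)
    then show "M \<in> ab_type ` X" using \<open>ab_type G = M\<close> by blast
  qed
  then have quot: "X // ab_iso = cls ` T" and inj: "inj_on cls T"
    using quotient_ab_iso[of X, OF fin] by (simp_all add: cls_def)
  have "unitary_count r n = (\<Sum>C\<in>cls ` T. num_unitary_factors (SOME G. G \<in> C))"
    by (simp add: unitary_count_def flip: X_def quot)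
  also have "\<dots> = (\<Sum>M\<in>T. num_unitary_factors (SOME G. G \<in> cls M))"
    using sum.reindex[OF inj] by simp
  also have "\<dots> = (\<Sum>M\<in>T. card (P M))"
  proof (rule sum.cong[OF refl])
    fix M assume M: "M \<in> T"
    have "\<exists>G. G \<in> cls M"
      using exists_nat_group_of_ab_type[of M] primepow[OF M] by (auto simp: cls_def)
    then have "(SOME G. G \<in> cls M) \<in> cls M" by (rule someI_ex)
    then show "num_unitary_factors (SOME G. G \<in> cls M) = card (P M)"
      by (simp add: cls_def P_def num_unitary_factors_eq)
  qed
  also have "\<dots> = card (SIGMA M:T. P M)"
  proof (rule card_SigmaI[symmetric])
    show "finite T"
      by (rule finite_subset[OF _ finite_msets_over_prod_le[of r n]]) (auto simp: T_def)
    have "finite (P M)" for M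
    proof (rule finite_subset)
      let ?S = "\<Union>k\<le>size M. multisets_of_size (set_mset M) k"
      show "P M \<subseteq> ?S \<times> ?S" by (auto simp: P_def multisets_of_size_def)
      show "finite (?S \<times> ?S)" by (intro finite_cartesian_product finite_UN_I finite_multisets_of_size) auto
    qed
    then show "\<forall>M\<in>T. finite (P M)" by blast
  qed
  also have "\<dots> = card {(A, B) \<in> disjoint_pairs ?Q. \<Prod>\<^sub># A * \<Prod>\<^sub># B = n}"
  proof (rule bij_betw_same_card, rule bij_betw_byWitness[where f = snd and f' = "\<lambda>(A, B). (A + B, A, B)"])
  qed (auto simp: P_def T_def disjoint_pairs_def msets_over_def)
  finally show ?thesis .
qed

theorem theorem2:
  fixes r :: nat and s :: complex
  assumes "r \<ge> 1" and "Re s > 1"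
  shows "(\<lambda>n. of_nat (unitary_count r (Suc n)) * of_nat (Suc n) powr (- s)) sums
           ((\<Prod>k=1..r. (riemann_zeta (of_nat k * s))\<^sup>2) /
            (\<Prod>k=1..r. riemann_zeta (of_nat (2 * k) * s)))"
  using disjoint_pairs_sums[OF assms(2), of r] by (simp only: unitary_count_eq zero_less_Suc)

end
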